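(* Let $n\in\mathbb{N}$. Then $$t(1,2,4,4;n)=-\sum_{d\mid 8n+11} d\left(\frac{2}{d}\right)-S_2(8n+11),$$ where the sum is over positive divisors $d$ of $8n+11$.
   Context: $\mathbb{N}$ denotes the set of positive integers. For $a,b,c,d\in\mathbb{N}$ and an integer $m\ge0$, $t(a,b,c,d;m)$ is the number of $(x,y,z,w)\in\mathbb{Z}^4$ with $m = a\frac{x(x-1)}{2}+b\frac{y(y-1)}{2}+c\frac{z(z-1)}{2}+d\frac{w(w-1)}{2}$. $\left(\frac{2}{d}\right)$ is the Jacobi (Kronecker) symbol. For $m,k\in\mathbb{N}$ with $m$ even and $k$ odd, $S_m(k)=\sum r$, the sum over all $(r,s)\in\mathbb{Z}\times\mathbb{Z}$ with $k=r^2+ms^2$ and $r\equiv1\pmod 4$. *)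

theory Defs
  imports "HOL-Number_Theory.Number_Theory"
begin

text \<open>The divisions below are exact, since a product of two consecutive integers is even. The set
  is finite when \<open>a, b, c, d\<close> are positive, which is the only case in which \<open>tri_reps\<close> is meant
  to be used.\<close>

definition tri_reps :: "nat \<Rightarrow> nat \<Rightarrow> nat \<Rightarrow> nat \<Rightarrow> nat \<Rightarrow> nat" where
  "tri_reps a b c d m = card {(x :: int, y :: int, z :: int, w :: int).
     int m = int a * (x * (x - 1) div 2) + int b * (y * (y - 1) div 2)
           + int c * (z * (z - 1) div 2) + int d * (w * (w - 1) div 2)}"

text \<open>The Jacobi symbol, for odd positive lower argument: the product of Legendre symbols over
  the prime factors of \<open>n\<close>, taken with multiplicity.\<close>

definition Jacobi :: "int \<Rightarrow> nat \<Rightarrow> int" where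
  "Jacobi a n = (\<Prod>p\<in>#prime_factorization n. Legendre a (int p))"

text \<open>The index set is finite for positive \<open>m\<close>.\<close>

definition S :: "nat \<Rightarrow> nat \<Rightarrow> int" where
  "S m k = (\<Sum>(r, s) \<in> {(r :: int, s :: int). int k = r ^ 2 + int m * s ^ 2 \<and> [r = 1] (mod 4)}. r)"

end

theory Submission
  imports Defs
begin

text \<open>Put \<open>N = 8 n + 11\<close>. Completing squares, and rotating the last two variables, turns the left side
  into the number of solutions of \<open>N = x\<^sup>2 + 2 y\<^sup>2 + 8 u\<^sup>2 + 8 v\<^sup>2\<close> with \<open>u + v\<close> odd, which is half of
  \<open>C - T\<close>, where \<open>C\<close> is the number of all solutions and \<open>T\<close> is the sum of \<open>(-1)\<close> to the power \<open>u + v\<close>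
  over all of them.

  Since \<open>N\<close> is 3 modulo 8, exactly one of \<open>y, a, b\<close> is odd whenever \<open>N = x\<^sup>2 + 2 (y\<^sup>2 + a\<^sup>2 + b\<^sup>2)\<close>, so
  that \<open>3 C\<close> counts the representations by this form. The divisor formulas for \<open>a\<^sup>2 + b\<^sup>2\<close> and
  \<open>x\<^sup>2 + 2 y\<^sup>2\<close> express this count as a convolution of two divisor sums, with characters modulo 4 and
  8, which Liouville's identity for the even function \<open>(2/\<cdot>)\<close> evaluates: \<open>C = - 2 \<Sum> d (2/d)\<close>.

  For fixed \<open>y\<close>, the formula for \<open>u\<^sup>2 + v\<^sup>2\<close> turns the inner sum of \<open>T\<close> into a weighted count of
  indefinite binary quadratic forms of discriminant \<open>M = N - 2 y\<^sup>2\<close>. Sign-reversing involutions cancel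
  everything unless \<open>M\<close> is a square, and the outcome is \<open>T = 2 S\<^sub>2(N)\<close>.\<close>

subsection \<open>The characters modulo 4 and 8\<close>

definition chi4 :: "int \<Rightarrow> int" where
  "chi4 k = (if k mod 4 = 1 then 1 else if k mod 4 = 3 then -1 else 0)"

definition chi8 :: "int \<Rightarrow> int" where
  "chi8 k = (if k mod 8 = 1 \<or> k mod 8 = 7 then 1 else if k mod 8 = 3 \<or> k mod 8 = 5 then -1 else 0)"

lemma chi4_cong: "a mod 4 = b mod 4 \<Longrightarrow> chi4 a = chi4 b"
  by (simp add: chi4_def)

lemma chi8_cong: "a mod 8 = b mod 8 \<Longrightarrow> chi8 a = chi8 b"
  by (simp add: chi8_def)

lemma chi4_mult: "chi4 (a * b) = chi4 a * chi4 b"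
proof -
  have *: "\<forall>r\<in>{0,1,2,3}. \<forall>s\<in>{0,1,2,3}. chi4 (r * s) = chi4 r * chi4 s"
    by (simp add: chi4_def)
  have m: "a mod 4 \<in> {0,1,2,3}" "b mod 4 \<in> {0,1,2,3}"
    unfolding insert_iff empty_iff by presburger+
  have "chi4 ((a mod 4) * (b mod 4)) = chi4 (a mod 4) * chi4 (b mod 4)"
    by (rule bspec[OF bspec[OF * m(1)] m(2)])
  moreover have "chi4 ((a mod 4) * (b mod 4)) = chi4 (a * b)"
    by (rule chi4_cong) (simp add: mod_mult_eq)
  moreover have "chi4 (a mod 4) = chi4 a" "chi4 (b mod 4) = chi4 b"
    by (rule chi4_cong, simp)+
  ultimately show ?thesis by (simp only:)
qed

lemma chi8_mult: "chi8 (a * b) = chi8 a * chi8 b"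
proof -
  have *: "\<forall>r\<in>{0,1,2,3,4,5,6,7}. \<forall>s\<in>{0,1,2,3,4,5,6,7}. chi8 (r * s) = chi8 r * chi8 s"
    by (simp add: chi8_def)
  have m: "a mod 8 \<in> {0,1,2,3,4,5,6,7}" "b mod 8 \<in> {0,1,2,3,4,5,6,7}"
    unfolding insert_iff empty_iff by presburger+
  have "chi8 ((a mod 8) * (b mod 8)) = chi8 (a mod 8) * chi8 (b mod 8)"
    by (rule bspec[OF bspec[OF * m(1)] m(2)])
  moreover have "chi8 ((a mod 8) * (b mod 8)) = chi8 (a * b)"
    by (rule chi8_cong) (simp add: mod_mult_eq)
  moreover have "chi8 (a mod 8) = chi8 a" "chi8 (b mod 8) = chi8 b"
    by (rule chi8_cong, simp)+
  ultimately show ?thesis by (simp only:)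
qed

lemma chi4_1 [simp]: "chi4 1 = 1" and chi8_1 [simp]: "chi8 1 = 1"
  by (simp_all add: chi4_def chi8_def)

lemma chi4_minus: "chi4 (- a) = - chi4 a"
  using chi4_mult[of "-1" a] by (simp add: chi4_def)

lemma chi8_minus: "chi8 (- a) = chi8 a"
  using chi8_mult[of "-1" a] by (simp add: chi8_def)

section \<open>Quadratic residue criteria for 2, -1 and -2\<close>

lemma neg_one_power_half:
  fixes p :: nat
  assumes "odd p"
  shows "(-1::int) ^ ((p - 1) div 2) = chi4 (int p)"
proof -
  have "p mod 4 = 1 \<or> p mod 4 = 3" using assms by presburger
  then show ?thesis
  proof
    assume *: "p mod 4 = 1"
    then have "even ((p - 1) div 2)" by presburger
    moreover have "int p mod 4 = 1" using * by presburger
    ultimately show ?thesis by (simp add: chi4_def)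
  next
    assume *: "p mod 4 = 3"
    then have "odd ((p - 1) div 2)" by presburger
    moreover have "int p mod 4 = 3" using * by presburger
    ultimately show ?thesis by (simp add: chi4_def)
  qed
qed

text \<open>Gauss's lemma with h = (p - 1) / 2: the symbol is -1 to the number of x in 1..h whose
  double exceeds h. There are \<open>h - h div 2\<close> of these, and the parity of this number
  depends only on h modulo 4, hence on p modulo 8.\<close>

lemma Legendre_two:
  fixes p :: nat
  assumes "prime p" "2 < p"
  shows "Legendre 2 (int p) = chi8 (int p)"
proof -
  have "\<not> int p dvd 2" using assms(2) zdvd_imp_le by fastforce
  then have "[2 \<noteq> 0] (mod int p)" by (simp add: cong_0_iff)
  then interpret GAUSS p 2 using assms by unfold_locales auto
  define h where "h = (int p - 1) div 2"
  have p: "int p = 2 * h + 1" using p_eq2 by (simp add: h_def)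
  have h0: "h \<ge> 0" using p assms(2) by linarith
  \<comment> \<open>The doubles stay below p, so reducing them modulo p changes nothing.\<close>
  have "C = (\<lambda>x. x * 2) ` {0<..h}"
    unfolding C_def B_def A_def image_image h_def[symmetric]
    by (rule image_cong[OF refl]) (use p in auto)
  then have "E = (\<lambda>x. x * 2) ` {h div 2<..h}"
    unfolding E_def h_def[symmetric] using h0 by (auto simp: image_iff)
  then have cE: "card E = nat (h - h div 2)"
    by (simp add: card_image inj_on_def)
  have "(-1::int) ^ nat (h - h div 2) = chi8 (int p)"
  proof -
    have par: "even (nat (h - h div 2)) \<longleftrightarrow> even (h - h div 2)"
      using h0 by (subst even_nat_iff) auto
    have "h mod 4 = 0 \<or> h mod 4 = 1 \<or> h mod 4 = 2 \<or> h mod 4 = 3" by presburger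
    then show ?thesis
    proof (elim disjE)
      assume *: "h mod 4 = 0"
      then have "even (h - h div 2)" "int p mod 8 = 1" unfolding p by presburger+
      then show ?thesis using par by (simp add: chi8_def)
    next
      assume *: "h mod 4 = 1"
      then have "odd (h - h div 2)" "int p mod 8 = 3" unfolding p by presburger+
      then show ?thesis using par by (simp add: chi8_def)
    next
      assume *: "h mod 4 = 2"
      then have "odd (h - h div 2)" "int p mod 8 = 5" unfolding p by presburger+
      then show ?thesis using par by (simp add: chi8_def)
    next
      assume *: "h mod 4 = 3"
      then have "even (h - h div 2)" "int p mod 8 = 7" unfolding p by presburger+
      then show ?thesis using par by (simp add: chi8_def)
    qed
  qed
  then show ?thesis using gauss_lemma cE by simp
qed

lemma Jacobi_two: "odd d \<Longrightarrow> Jacobi 2 d = chi8 (int d)"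
proof (induction d rule: prime_divisors_induct)
  case (unit x)
  then show ?case by (simp add: Jacobi_def)
next
  case (factor p x)
  then have p: "prime p" "odd p" "odd x" "x \<noteq> 0" by (auto intro: Nat.gr0I)
  then have "p > 2" using prime_gt_1_nat[of p] by presburger
  have "Jacobi 2 (p * x) = Legendre 2 (int p) * Jacobi 2 x"
    using p by (simp add: Jacobi_def prime_factorization_mult prime_factorization_prime)
  then show ?case
    using factor p Legendre_two[OF \<open>prime p\<close> \<open>p > 2\<close>] by (simp add: chi8_mult)
qed simp

text \<open>Euler's criterion gives each Legendre symbol modulo p only. Since p > 2, the values 1
  and -1 are incongruent, so a congruence with a sign c already decides whether the symbol is 1. For
  -2 the power splits into those of -1 and 2.\<close>

lemma
  fixes p :: nat
  assumes "prime p" "2 < p"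
  shows QuadRes_neg_one_iff: "QuadRes (int p) (-1) \<longleftrightarrow> chi4 (int p) = 1"
    and QuadRes_neg_two_iff: "QuadRes (int p) (-2) \<longleftrightarrow> chi4 (int p) * chi8 (int p) = 1"
proof -
  have odd: "odd p" using assms prime_odd_nat by blast
  have *: "QuadRes (int p) a \<longleftrightarrow> c = 1"
    if c: "c = 1 \<or> c = -1" "[c = a ^ ((p - 1) div 2)] (mod int p)" "\<not> int p dvd a" for a c :: int
  proof -
    have L: "[Legendre a (int p) = c] (mod int p)"
      using euler_criterion[OF assms, of a] c(2) cong_sym cong_trans by blast
    have nz: "[a \<noteq> 0] (mod int p)" using c(3) by (simp add: cong_0_iff)
    have n: "\<not> [1 = - 1] (mod int p)" "\<not> [- 1 = 1] (mod int p)"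
      using assms(2) zdvd_imp_le[of "int p" 2] by (auto simp: cong_iff_dvd_diff)
    show ?thesis
      using L c(1) n nz unfolding Legendre_def by (auto split: if_splits)
  qed
  have m4: "chi4 (int p) = 1 \<or> chi4 (int p) = -1"
    using odd neg_one_power_half[OF odd] by (metis neg_one_even_power neg_one_odd_power)
  have "int p mod 8 = 1 \<or> int p mod 8 = 3 \<or> int p mod 8 = 5 \<or> int p mod 8 = 7"
    using odd by presburger
  then have m8: "chi8 (int p) = 1 \<or> chi8 (int p) = -1" by (auto simp: chi8_def)
  have nd: "\<not> int p dvd -1" "\<not> int p dvd -2"
    using assms(2) zdvd_imp_le[of "int p" 2] zdvd_imp_le[of "int p" 1] by auto
  show "QuadRes (int p) (-1) \<longleftrightarrow> chi4 (int p) = 1"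
    using m4 neg_one_power_half[OF odd] nd by (intro *) auto
  have "[chi8 (int p) = 2 ^ ((p - 1) div 2)] (mod int p)"
    using euler_criterion[OF assms, of 2] Legendre_two[OF assms] by simp
  then have "[chi4 (int p) * chi8 (int p) = (-1) ^ ((p - 1) div 2) * 2 ^ ((p - 1) div 2)] (mod int p)"
    using neg_one_power_half[OF odd] by (simp add: cong_scalar_left)
  then have "[chi4 (int p) * chi8 (int p) = (-2) ^ ((p - 1) div 2)] (mod int p)"
    by (simp flip: power_mult_distrib)
  then show "QuadRes (int p) (-2) \<longleftrightarrow> chi4 (int p) * chi8 (int p) = 1"
    using m4 m8 nd by (intro *) auto
qed

subsection \<open>Representations by \<open>x\<^sup>2 + y\<^sup>2\<close> and \<open>x\<^sup>2 + 2 y\<^sup>2\<close>\<close>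

definition reps :: "int \<Rightarrow> int \<Rightarrow> (int \<times> int) set" where
  "reps D k = {(x, y). x\<^sup>2 + D * y\<^sup>2 = k}"

definition divisor_sum :: "(int \<Rightarrow> int) \<Rightarrow> nat \<Rightarrow> int" where
  "divisor_sum f n = (\<Sum>d | d dvd n. f (int d))"

lemma abs_le_square_int: "\<bar>x::int\<bar> \<le> x\<^sup>2"
proof (cases "x = 0")
  case False
  then have "\<bar>x\<bar> * 1 \<le> \<bar>x\<bar> * \<bar>x\<bar>" by (intro mult_left_mono) auto
  then show ?thesis by (simp add: power2_eq_square)
qed simp

lemma finite_reps:
  assumes "D \<ge> 1"
  shows "finite (reps D k)"
proof (rule finite_subset)
  show "reps D k \<subseteq> {-k..k} \<times> {-k..k}"
  proof clarify
    fix x y assume "(x, y) \<in> reps D k"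
    then have k: "x\<^sup>2 + D * y\<^sup>2 = k" by (simp add: reps_def)
    have "y\<^sup>2 \<le> D * y\<^sup>2" using assms by (simp add: mult_le_cancel_right1)
    then have "\<bar>x\<bar> \<le> k" "\<bar>y\<bar> \<le> k"
      using abs_le_square_int[of x] abs_le_square_int[of y] k zero_le_power2[of x] zero_le_power2[of y]
      by linarith+
    then show "x \<in> {-k..k} \<and> y \<in> {-k..k}" by auto
  qed
qed simp

section \<open>Small solutions of linear congruences, and primes of the form a^2 + D b^2\<close>

text \<open>Pigeonhole: with s the integer part of the square root of p, there are (s + 1)^2 > p
  pairs in {0..s} x {0..s}, so two of them give the same residue x - h y. Their difference is (a,
  b).\<close>

lemma thue:
  fixes p :: nat and h :: int
  assumes "prime p"
  obtains a b :: int where "(a, b) \<noteq> (0, 0)" "a\<^sup>2 < p" "b\<^sup>2 < p" "int p dvd a - h * b"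
proof -
  define s where "s = (GREATEST s. s\<^sup>2 \<le> p)"
  have bound: "\<forall>y. y\<^sup>2 \<le> p \<longrightarrow> y \<le> p"
    using le_trans power2_nat_le_imp_le by blast
  have le: "s\<^sup>2 \<le> p" unfolding s_def
    by (rule GreatestI_nat[where k = 0 and b = p]) (use bound in auto)
  have "\<not> (Suc s)\<^sup>2 \<le> p"
  proof
    assume "(Suc s)\<^sup>2 \<le> p"
    then have "Suc s \<le> s"
      unfolding s_def using bound by (intro Greatest_le_nat[where b = p]) simp_all
    then show False by simp
  qed
  then have gt: "p < (Suc s)\<^sup>2" by simp
  \<comment> \<open>A prime is not a square; this makes the bounds on a^2 and b^2 strict.\<close>
  have "s\<^sup>2 \<noteq> p" using assms by (auto simp: prime_power_iff)
  then have lt: "s\<^sup>2 < p" using le by simp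
  define I where "I = {0..int s} \<times> {0..int s}"
  define f where "f = (\<lambda>(x, y). (x - h * y) mod int p)"
  have "p > 0" using assms prime_gt_0_nat by blast
  then have "f ` I \<subseteq> {0..<int p}" by (auto simp: f_def)
  then have "card (f ` I) \<le> p" using card_mono[of "{0..<int p}"] by simp
  also have "p < card I" using gt by (simp add: I_def power2_eq_square card_cartesian_product nat_add_distrib)
  finally have "\<not> inj_on f I" using card_image by fastforce
  then obtain x y x' y' where 1: "(x, y) \<in> I" "(x', y') \<in> I" "f (x, y) = f (x', y')" "(x, y) \<noteq> (x', y')"
    unfolding inj_on_def by (metis surj_pair)
  have sq: "c\<^sup>2 < p" if "\<bar>c\<bar> \<le> int s" for c :: int
  proof -
    have "c\<^sup>2 \<le> (int s)\<^sup>2" using that by (metis abs_le_square_iff abs_of_nat)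
    also have "\<dots> < int p" using lt by (metis of_nat_less_iff of_nat_power)
    finally show ?thesis .
  qed
  show thesis
  proof
    show "(x - x', y - y') \<noteq> (0, 0)" using 1 by auto
    show "(x - x')\<^sup>2 < p" "(y - y')\<^sup>2 < p" using 1 by (auto simp: I_def intro!: sq)
    have "int p dvd (x - h * y) - (x' - h * y')"
      using 1(3) by (simp add: f_def mod_eq_dvd_iff)
    then show "int p dvd (x - x') - h * (y - y')" by (simp add: algebra_simps)
  qed
qed

text \<open>If h^2 = -D and a = h b modulo p, then p divides a^2 + D b^2. Thue's bounds put this
  value strictly between 0 and (D + 1) p, so it is p, or possibly 2 p when D = 2.\<close>

lemma prime_eq_square_plus:
  fixes p :: nat and D :: int
  assumes "prime p" "2 < p" "QuadRes (int p) (- D)" "D = 1 \<or> D = 2"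
  obtains a b :: int where "a\<^sup>2 + D * b\<^sup>2 = int p"
proof -
  obtain h where "[h\<^sup>2 = - D] (mod int p)" using assms(3) by (auto simp: QuadRes_def)
  then have h: "int p dvd h\<^sup>2 + D" by (simp add: cong_iff_dvd_diff)
  obtain a b :: int where ab: "(a, b) \<noteq> (0, 0)" "a\<^sup>2 < p" "b\<^sup>2 < p" "int p dvd a - h * b"
    by (rule thue[OF assms(1)])
  have "a\<^sup>2 + D * b\<^sup>2 = (a - h * b) * (a + h * b) + (h\<^sup>2 + D) * b\<^sup>2"
    by (simp add: algebra_simps power2_eq_square)
  then have "int p dvd a\<^sup>2 + D * b\<^sup>2" using h ab(4) by (metis dvd_add dvd_mult2)
  then obtain k where k: "a\<^sup>2 + D * b\<^sup>2 = int p * k" by auto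
  have p0: "int p > 0" using assms(2) by simp
  have "a\<^sup>2 \<ge> 0" "b\<^sup>2 \<ge> 0" "a\<^sup>2 > 0 \<or> b\<^sup>2 > 0" using ab(1) by auto
  then have "a\<^sup>2 + D * b\<^sup>2 > 0"
    using assms(4) by (elim disjE) (simp_all add: add_pos_nonneg add_nonneg_pos)
  moreover have "a\<^sup>2 + D * b\<^sup>2 < int p * (D + 1)"
    using ab(2,3) assms(4) by (auto simp: algebra_simps)
  ultimately have "k > 0" "k < D + 1" using k p0 by (simp_all add: zero_less_mult_iff)
  then consider "k = 1" | "k = 2" "D = 2" using assms(4) by linarith
  then show thesis
  proof cases
    case 1
    then show thesis using k that by simp
  next
    \<comment> \<open>From a^2 + 2 b^2 = 2 p with a = 2 c, halving gives b^2 + 2 c^2 = p: the two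
      squares exchange roles.\<close>
    case 2
    then have "a\<^sup>2 = 2 * (int p - b\<^sup>2)" using k by simp
    then have "even (a\<^sup>2)" by simp
    then have "even a" by simp
    then obtain c where c: "a = 2 * c" by (rule evenE)
    have "b\<^sup>2 + D * c\<^sup>2 = int p" using k 2 c by (simp add: power_mult_distrib)
    then show thesis using that by blast
  qed
qed

section \<open>Recurrences under multiplication by a prime\<close>

text \<open>The divisors of p m are those of m together with their multiples by p.
  Inclusion-exclusion subtracts the overlap, which consists of p times the divisors of m / p and is
  empty unless p divides m.\<close>

lemma divisor_sum_prime_mult:
  fixes p m :: nat
  assumes p: "prime p" and m: "m > 0" and mult: "\<And>a b. f (a * b) = f a * f b"
  shows "divisor_sum f (p * m) = (1 + f (int p)) * divisor_sum f m
     - f (int p) * (if p dvd m then divisor_sum f (m div p) else 0)"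
proof -
  let ?A = "{d. d dvd m}"
  have p0: "p > 0" using p prime_gt_0_nat by blast
  have fin: "finite ?A" using m by simp
  have "{d. d dvd p * m} = ?A \<union> (*) p ` ?A"
  proof (intro equalityI subsetI)
    fix d assume d: "d \<in> {d. d dvd p * m}"
    show "d \<in> ?A \<union> (*) p ` ?A"
    proof (cases "p dvd d")
      case True
      then obtain e where "d = p * e" by auto
      then show ?thesis using d p0 by auto
    next
      case False
      then have "coprime d p" using p prime_imp_coprime coprime_commute by blast
      then show ?thesis using d by (simp add: coprime_dvd_mult_right_iff)
    qed
  qed auto
  then have "divisor_sum f (p * m) + (\<Sum>d\<in>?A \<inter> (*) p ` ?A. f (int d))
     = divisor_sum f m + (\<Sum>d\<in>(*) p ` ?A. f (int d))"
    unfolding divisor_sum_def using fin by (simp add: sum.union_inter)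
  also have "(\<Sum>d\<in>(*) p ` ?A. f (int d)) = f (int p) * divisor_sum f m"
    using p0 by (simp add: sum.reindex inj_on_def mult divisor_sum_def sum_distrib_left)
  finally have 1: "divisor_sum f (p * m)
     = (1 + f (int p)) * divisor_sum f m - (\<Sum>d\<in>?A \<inter> (*) p ` ?A. f (int d))"
    by (simp add: algebra_simps)
  show ?thesis
  proof (cases "p dvd m")
    case False
    then have "?A \<inter> (*) p ` ?A = {}" by (auto dest: dvd_mult_left)
    then show ?thesis using 1 False by simp
  next
    case True
    then obtain n where n: "m = p * n" by auto
    have "?A \<inter> (*) p ` ?A = (*) p ` {d. d dvd n}"
      using p0 n by (auto simp: image_iff)
    then have "(\<Sum>d\<in>?A \<inter> (*) p ` ?A. f (int d)) = f (int p) * divisor_sum f n"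
      using p0 by (simp add: sum.reindex inj_on_def mult divisor_sum_def sum_distrib_left)
    then show ?thesis using 1 True n p0 by simp
  qed
qed

text \<open>The pairs counted on the left are the multiples of \<open>a + b \<surd>(-D)\<close>: multiplication by this
  element, which has norm \<open>q\<close>, is the bijection.\<close>

lemma card_reps_divisible_by:
  fixes D a b m q :: int
  assumes ab: "a\<^sup>2 + D * b\<^sup>2 = q" and q: "q > 0" "prime q"
  shows "card {(x, y) \<in> reps D (q * m). q dvd x * b - y * a} = card (reps D m)"
proof -
  define f where "f = (\<lambda>(u, v). (u * a - D * v * b, u * b + v * a))"
  \<comment> \<open>Division by a + b sqrt(-D): multiplication by the conjugate, then division by
    the norm q.\<close>
  define g where "g = (\<lambda>(x, y). ((x * a + D * y * b) div q, (y * a - x * b) div q))"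
  have norm_f: "(u * a - D * v * b)\<^sup>2 + D * (u * b + v * a)\<^sup>2 = q * (u\<^sup>2 + D * v\<^sup>2)" for u v
    unfolding ab[symmetric] by (simp add: algebra_simps power2_eq_square)
  have gf: "g (f (u, v)) = (u, v)" for u v
  proof -
    have "(u * a - D * v * b) * a + D * (u * b + v * a) * b = q * u"
      "(u * b + v * a) * a - (u * a - D * v * b) * b = q * v"
      unfolding ab[symmetric] by (simp_all add: algebra_simps power2_eq_square)
    then show ?thesis using q by (simp add: f_def g_def)
  qed
  have *: "f (g (x, y)) = (x, y) \<and> g (x, y) \<in> reps D m"
    if "x\<^sup>2 + D * y\<^sup>2 = q * m" "q dvd x * b - y * a" for x y
  proof -
    \<comment> \<open>Multiplicativity of the norm, applied to the product with the conjugate: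
      divisibility of one coordinate by q forces that of the other.\<close>
    have "(x * a + D * y * b)\<^sup>2 = q * (q * m) - D * (x * b - y * a)\<^sup>2"
      unfolding that(1)[symmetric] unfolding ab[symmetric] by (simp add: algebra_simps power2_eq_square)
    moreover have "q dvd D * (x * b - y * a)\<^sup>2" using that(2) by (simp add: power2_eq_square)
    ultimately have "q dvd (x * a + D * y * b)\<^sup>2" by simp
    then have "q dvd x * a + D * y * b" using q(2) prime_dvd_power by blast
    then obtain u where u: "x * a + D * y * b = q * u" by auto
    have "q dvd y * a - x * b" using that(2) by (metis dvd_minus_iff minus_diff_eq)
    then obtain v where v: "y * a - x * b = q * v" by auto
    have g: "g (x, y) = (u, v)" using u v q by (simp add: g_def)
    have "q * (u * a - D * v * b) = (q * u) * a - D * (q * v) * b" by (simp add: algebra_simps)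
    also have "\<dots> = q * x"
      unfolding u[symmetric] v[symmetric] unfolding ab[symmetric] by (simp add: algebra_simps power2_eq_square)
    finally have x: "u * a - D * v * b = x" using q by simp
    have "q * (u * b + v * a) = (q * u) * b + (q * v) * a" by (simp add: algebra_simps)
    also have "\<dots> = q * y"
      unfolding u[symmetric] v[symmetric] unfolding ab[symmetric] by (simp add: algebra_simps power2_eq_square)
    finally have y: "u * b + v * a = y" using q by simp
    have "q * (u\<^sup>2 + D * v\<^sup>2) = q * m" using norm_f[of u v] unfolding x y that(1) by (rule sym)
    then have "u\<^sup>2 + D * v\<^sup>2 = m" using q(1) by (metis mult_left_cancel less_irrefl)
    then show ?thesis using g x y by (simp add: f_def reps_def)
  qed
  have "\<forall>w\<in>reps D m. g (f w) = w" using gf by auto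
  moreover have "\<forall>w\<in>{(x, y) \<in> reps D (q * m). q dvd x * b - y * a}. f (g w) = w"
    using * by (auto simp: reps_def)
  moreover have "g ` {(x, y) \<in> reps D (q * m). q dvd x * b - y * a} \<subseteq> reps D m"
  proof (rule image_subsetI)
    fix w assume "w \<in> {(x, y) \<in> reps D (q * m). q dvd x * b - y * a}"
    then show "g w \<in> reps D m" using *[of "fst w" "snd w"] by (simp add: reps_def case_prod_unfold)
  qed
  moreover have "f ` reps D m \<subseteq> {(x, y) \<in> reps D (q * m). q dvd x * b - y * a}"
  proof (rule image_subsetI)
    fix w assume "w \<in> reps D m"
    then obtain u v where w: "w = (u, v)" "u\<^sup>2 + D * v\<^sup>2 = m" by (auto simp: reps_def)
    have "(u * a - D * v * b) * b - (u * b + v * a) * a = q * (- v)"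
      unfolding ab[symmetric] by (simp add: algebra_simps power2_eq_square)
    then show "f w \<in> {(x, y) \<in> reps D (q * m). q dvd x * b - y * a}"
      using norm_f[of u v] by (simp add: f_def reps_def w)
  qed
  ultimately have "bij_betw f (reps D m) ({(x, y) \<in> reps D (q * m). q dvd x * b - y * a})"
    by (intro bij_betw_byWitness[where f' = g])
  then show ?thesis by (rule bij_betw_same_card[symmetric])
qed

text \<open>Removing a factor q from both coordinates divides the value by q^2. This set is the
  overlap in the split case and the whole set of representations in the inert case.\<close>

lemma card_reps_both_divisible:
  fixes D q m :: int
  assumes "q \<noteq> 0"
  shows "card {(x, y) \<in> reps D (q * m). q dvd x \<and> q dvd y}
    = (if q dvd m then card (reps D (m div q)) else 0)"
proof (cases "q dvd m")
  case True
  then obtain n where n: "m = q * n" by auto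
  have "{(x, y) \<in> reps D (q * m). q dvd x \<and> q dvd y} = (\<lambda>(u, v). (q * u, q * v)) ` reps D n"
  proof (intro equalityI subsetI)
    fix w assume "w \<in> {(x, y) \<in> reps D (q * m). q dvd x \<and> q dvd y}"
    then obtain x y where "w = (x, y)" "q dvd x" "q dvd y" "x\<^sup>2 + D * y\<^sup>2 = q * m"
      by (auto simp: reps_def)
    moreover from this obtain u v where "x = q * u" "y = q * v" unfolding dvd_def by blast
    ultimately have w: "w = (q * u, q * v)" and "(q * u)\<^sup>2 + D * (q * v)\<^sup>2 = q * m"
      by simp_all
    then have "(q * q) * (u\<^sup>2 + D * v\<^sup>2) = (q * q) * n"
      by (simp add: n algebra_simps power2_eq_square)
    then have "u\<^sup>2 + D * v\<^sup>2 = n" using assms by simp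
    then show "w \<in> (\<lambda>(u, v). (q * u, q * v)) ` reps D n" using w by (auto simp: reps_def)
  next
    fix w assume "w \<in> (\<lambda>(u, v). (q * u, q * v)) ` reps D n"
    then show "w \<in> {(x, y) \<in> reps D (q * m). q dvd x \<and> q dvd y}"
      by (auto simp: reps_def n algebra_simps power2_eq_square)
  qed
  moreover have "inj_on (\<lambda>(u, v). (q * u, q * v)) (reps D n)"
    using assms by (auto simp: inj_on_def)
  ultimately show ?thesis using True n assms by (simp add: card_image)
next
  case False
  have "q dvd m" if "(x, y) \<in> reps D (q * m)" "q dvd x" "q dvd y" for x y
  proof -
    from that(2,3) obtain u v where "x = q * u" "y = q * v" unfolding dvd_def by blast
    then have "q * m = q * (q * (u\<^sup>2 + D * v\<^sup>2))"
      using that(1) by (simp add: reps_def algebra_simps power2_eq_square)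
    then show ?thesis using assms by auto
  qed
  then have "{(x, y) \<in> reps D (q * m). q dvd x \<and> q dvd y} = {}" using False by auto
  then show ?thesis using False by (simp only: card.empty if_False)
qed

text \<open>Every representation of q m is a multiple of a + b sqrt(-D) or of its conjugate. Each
  kind is counted by \<open>card_reps_divisible_by\<close>, and those of both kinds have both
  coordinates divisible by q.\<close>

lemma card_reps_split_prime:
  fixes D a b m q :: int
  assumes ab: "a\<^sup>2 + D * b\<^sup>2 = q" and q: "prime q" "q > 2" and D: "D = 1 \<or> D = 2"
  shows "int (card (reps D (q * m))) = 2 * int (card (reps D m))
    - int (if q dvd m then card (reps D (m div q)) else 0)"
proof -
  let ?A = "{(x, y) \<in> reps D (q * m). q dvd x * b - y * a}"
  let ?B = "{(x, y) \<in> reps D (q * m). q dvd x * (- b) - y * a}"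
  have fin: "finite (reps D (q * m))" using D by (intro finite_reps) auto
  have small: "\<not> q dvd c" if "0 < c\<^sup>2" "c\<^sup>2 \<le> q" for c
  proof
    assume "q dvd c"
    then have "q * q dvd c\<^sup>2" by (simp add: power2_eq_square mult_dvd_mono)
    then have "q * q \<le> q * 1" using that zdvd_imp_le by fastforce
    then show False using q by (subst (asm) mult_le_cancel_left_pos) auto
  qed
  \<comment> \<open>This rules out a = 0 and b = 0; then 0 < a^2, b^2 <= q shows that q divides
    neither a nor b.\<close>
  have nsq: "c\<^sup>2 \<noteq> q" "2 * c\<^sup>2 \<noteq> q" for c
  proof -
    show "c\<^sup>2 \<noteq> q" using q(1) by (auto simp: prime_power_iff)
    show "2 * c\<^sup>2 \<noteq> q" using q prime_odd_int[of q] dvd_triv_left[of 2 "c\<^sup>2"] by auto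
  qed
  have "a \<noteq> 0" "b \<noteq> 0" using ab nsq[of a] nsq[of b] D by auto
  then have pos: "a\<^sup>2 > 0" "b\<^sup>2 > 0" by auto
  then have "a\<^sup>2 \<le> q" "b\<^sup>2 \<le> q" using ab D by auto
  then have nd: "\<not> q dvd a" "\<not> q dvd b" "\<not> q dvd 2"
    using small pos q by (auto dest: zdvd_imp_le)
  have "reps D (q * m) = ?A \<union> ?B"
  proof -
    have "q dvd x * b - y * a \<or> q dvd x * (- b) - y * a" if "x\<^sup>2 + D * y\<^sup>2 = q * m" for x y
    proof -
      \<comment> \<open>The product is a^2 y^2 - b^2 x^2, a combination of the two norms, both
        divisible by q; as q is prime, it divides one of the factors.\<close>
      have "(x * b - y * a) * (x * (- b) - y * a) = q * y\<^sup>2 - b\<^sup>2 * (x\<^sup>2 + D * y\<^sup>2)"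
        unfolding ab[symmetric] by (simp add: algebra_simps power2_eq_square)
      then have "q dvd (x * b - y * a) * (x * (- b) - y * a)" unfolding that by simp
      then show ?thesis using q prime_dvd_multD by blast
    qed
    then show ?thesis by (auto simp: reps_def)
  qed
  moreover have "?A \<inter> ?B = {(x, y) \<in> reps D (q * m). q dvd x \<and> q dvd y}"
  proof -
    have "q dvd x \<and> q dvd y" if d: "q dvd x * b - y * a" "q dvd x * (- b) - y * a" for x y
    proof -
      have "2 * (x * b) = (x * b - y * a) - (x * (- b) - y * a)"
        "2 * (y * a) = - ((x * b - y * a) + (x * (- b) - y * a))" by (simp_all add: algebra_simps)
      then have "q dvd 2 * (x * b)" "q dvd 2 * (y * a)"
        using d by (simp_all only: dvd_diff dvd_add dvd_minus_iff)
      then show ?thesis using nd q by (simp add: prime_dvd_mult_iff)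
    qed
    then have "(q dvd x * b - y * a \<and> q dvd x * (- b) - y * a) = (q dvd x \<and> q dvd y)" for x y
      by (meson dvd_diff dvd_mult2)
    moreover have "?A \<inter> ?B = {(x, y) \<in> reps D (q * m). q dvd x * b - y * a \<and> q dvd x * (- b) - y * a}"
      by blast
    ultimately show ?thesis by simp
  qed
  moreover have "finite ?A" "finite ?B" using fin by (auto intro: finite_subset)
  ultimately have "int (card (reps D (q * m)))
     = int (card ?A) + int (card ?B) - int (card {(x, y) \<in> reps D (q * m). q dvd x \<and> q dvd y})"
    using card_Un_Int[of ?A ?B] by simp
  then show ?thesis
    using card_reps_divisible_by[OF ab _ q(1), of m] card_reps_divisible_by[of a D "- b" q m] ab q
      card_reps_both_divisible[of q D m] by simp
qed

text \<open>The bijection \<open>f\<close> is multiplication by 1 + i, an element of norm 2.\<close>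

lemma card_reps_2_1: "card (reps 1 (2 * m)) = card (reps 1 m)"
proof -
  define f where "f = (\<lambda>(u::int, v::int). (u - v, u + v))"
  define g where "g = (\<lambda>(x::int, y::int). ((x + y) div 2, (y - x) div 2))"
  have *: "f (g (x, y)) = (x, y) \<and> g (x, y) \<in> reps 1 m" if "x\<^sup>2 + y\<^sup>2 = 2 * m" for x y
  proof -
    have "even (x\<^sup>2 + y\<^sup>2)" using that by simp
    then have "even (x + y)" by simp
    then obtain u where "x + y = 2 * u" by (rule evenE)
    then have x: "y = 2 * u - x" by simp
    have "2 * (u\<^sup>2 + (u - x)\<^sup>2) = 2 * m"
      unfolding that[symmetric] x by (simp add: algebra_simps power2_eq_square)
    then show ?thesis by (simp add: x f_def g_def reps_def)
  qed
  have "\<forall>w\<in>reps 1 m. g (f w) = w" by (auto simp: f_def g_def)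
  moreover have "\<forall>w\<in>reps 1 (2 * m). f (g w) = w" using * by (auto simp: reps_def)
  moreover have "g ` reps 1 (2 * m) \<subseteq> reps 1 m"
  proof (rule image_subsetI)
    fix w assume "w \<in> reps 1 (2 * m)"
    then show "g w \<in> reps 1 m" using *[of "fst w" "snd w"] by (simp add: reps_def case_prod_unfold)
  qed
  moreover have "f ` reps 1 m \<subseteq> reps 1 (2 * m)" by (auto simp: f_def g_def reps_def algebra_simps power2_eq_square)
  ultimately have "bij_betw f (reps 1 m) (reps 1 (2 * m))"
    by (intro bij_betw_byWitness[where f' = g])
  then show ?thesis by (rule bij_betw_same_card[symmetric])
qed

text \<open>The bijection \<open>f\<close> is multiplication by sqrt(-2), up to the sign of the
  first coordinate.\<close>

lemma card_reps_2_2: "card (reps 2 (2 * m)) = card (reps 2 m)"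
proof -
  define f where "f = (\<lambda>(u::int, v::int). (2 * v, u))"
  define g where "g = (\<lambda>(x::int, y::int). (y, x div 2))"
  have *: "f (g (x, y)) = (x, y) \<and> g (x, y) \<in> reps 2 m" if "x\<^sup>2 + 2 * y\<^sup>2 = 2 * m" for x y
  proof -
    have "x\<^sup>2 = 2 * (m - y\<^sup>2)" using that by simp
    then have "even (x\<^sup>2)" by simp
    then have "even x" by simp
    then obtain u where x: "x = 2 * u" by (rule evenE)
    then show ?thesis using that by (simp add: f_def g_def reps_def power_mult_distrib)
  qed
  have "\<forall>w\<in>reps 2 m. g (f w) = w" by (auto simp: f_def g_def)
  moreover have "\<forall>w\<in>reps 2 (2 * m). f (g w) = w" using * by (auto simp: reps_def)
  moreover have "g ` reps 2 (2 * m) \<subseteq> reps 2 m"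
  proof (rule image_subsetI)
    fix w assume "w \<in> reps 2 (2 * m)"
    then show "g w \<in> reps 2 m" using *[of "fst w" "snd w"] by (simp add: reps_def case_prod_unfold)
  qed
  moreover have "f ` reps 2 m \<subseteq> reps 2 (2 * m)" by (auto simp: f_def g_def reps_def algebra_simps power2_eq_square)
  ultimately have "bij_betw f (reps 2 m) (reps 2 (2 * m))"
    by (intro bij_betw_byWitness[where f' = g])
  then show ?thesis by (rule bij_betw_same_card[symmetric])
qed

lemma card_reps_1: "card (reps 1 1) = 4" "card (reps 2 1) = 2"
proof -
  have "\<bar>x\<bar> \<le> 1" if "x\<^sup>2 \<le> 1" for x :: int
    using that abs_le_square_int[of x] by linarith
  then have le: "x \<in> {-1, 0, 1}" if "x\<^sup>2 \<le> 1" for x :: int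
    using that by (fastforce simp: abs_le_iff)
  have "x\<^sup>2 \<le> 1 \<and> y\<^sup>2 \<le> 1" if "x\<^sup>2 + y\<^sup>2 = 1" for x y :: int
    using that zero_le_power2[of x] zero_le_power2[of y] by linarith
  then have "reps 1 1 = {(x, y) \<in> {-1, 0, 1} \<times> {-1, 0, 1}. x\<^sup>2 + y\<^sup>2 = 1}"
    using le by (auto simp: reps_def simp del: insert_iff insertCI)
  also have "\<dots> = {(1, 0), (-1, 0), (0, 1), (0, -1)}" by auto
  finally show "card (reps 1 1) = 4" by simp
  have "x\<^sup>2 \<le> 1 \<and> y\<^sup>2 \<le> 1" if "x\<^sup>2 + 2 * y\<^sup>2 = 1" for x y :: int
    using that zero_le_power2[of x] zero_le_power2[of y] by linarith
  then have "reps 2 1 = {(x, y) \<in> {-1, 0, 1} \<times> {-1, 0, 1}. x\<^sup>2 + 2 * y\<^sup>2 = 1}"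
    using le by (auto simp: reps_def simp del: insert_iff insertCI)
  also have "\<dots> = {(1, 0), (-1, 0)}" by auto
  finally show "card (reps 2 1) = 2" by simp
qed

text \<open>If p did not divide y, then x / y would be a square root of -D modulo p.\<close>

lemma inert_prime_dvd:
  fixes p :: nat and D x y :: int
  assumes "prime p" "\<not> QuadRes (int p) (- D)" "int p dvd x\<^sup>2 + D * y\<^sup>2"
  shows "int p dvd x \<and> int p dvd y"
proof -
  have pr: "prime (int p)" using assms(1) by simp
  have "int p dvd y"
  proof (rule ccontr)
    assume "\<not> int p dvd y"
    then have "coprime y (int p)" using pr prime_imp_coprime coprime_commute by blast
    then obtain z where z: "[y * z = 1] (mod int p)" using cong_solve_coprime_int by blast
    have "[0 = (x\<^sup>2 + D * y\<^sup>2) * z\<^sup>2] (mod int p)"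
      using assms(3) by (intro cong_sym[of _ 0]) (simp add: cong_0_iff)
    also have "(x\<^sup>2 + D * y\<^sup>2) * z\<^sup>2 = (x * z)\<^sup>2 + D * (y * z)\<^sup>2"
      by (simp add: algebra_simps power2_eq_square)
    also have "[\<dots> = (x * z)\<^sup>2 + D * 1\<^sup>2] (mod int p)"
      using z by (intro cong_add cong_mult cong_pow cong_refl)
    finally have "[(x * z)\<^sup>2 = - D] (mod int p)"
      by (metis (no_types, lifting) cong_sym_eq cong_iff_dvd_diff cong_0_iff diff_minus_eq_add mult.right_neutral power_one)
    then show False using assms(2) by (auto simp: QuadRes_def)
  qed
  moreover have "int p dvd x\<^sup>2"
    using assms(3) \<open>int p dvd y\<close> by (metis dvd_add_left_iff dvd_mult dvd_power_same dvd_trans dvd_mult2 power2_eq_square)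
  ultimately show ?thesis using pr prime_dvd_power by blast
qed

text \<open>Both sides satisfy the recurrence \<open>g (p m) = (1 + f p) g m - f p * g (m / p)\<close> for every
  prime \<open>p\<close>, where the last term is absent unless \<open>p\<close> divides \<open>m\<close>.\<close>

lemma card_reps_eq_divisor_sum:
  fixes D w :: int and f :: "int \<Rightarrow> int"
  assumes D: "D = 1 \<or> D = 2"
    and mult: "\<And>a b. f (a * b) = f a * f b" and one: "f 1 = 1" and two: "f 2 = 0"
    and range: "\<And>a. odd a \<Longrightarrow> f a = 1 \<or> f a = -1"
    and QR: "\<And>p. prime p \<Longrightarrow> 2 < p \<Longrightarrow> QuadRes (int p) (- D) \<longleftrightarrow> f (int p) = 1"
    and w: "int (card (reps D 1)) = w"
    and n: "n > 0"
  shows "int (card (reps D (int n))) = w * divisor_sum f n"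
  using n
proof (induction n rule: less_induct)
  case (less n)
  show ?case
  proof (cases "n = 1")
    case True
    then show ?thesis using w one by (simp add: divisor_sum_def)
  next
    case False
    then obtain p where p: "prime p" "p dvd n" using prime_factor_nat by blast
    then obtain m where m: "n = p * m" by auto
    have p1: "p > 1" using p prime_gt_1_nat by blast
    have m0: "m > 0" "m < n" using less.prems m p1 by auto
    have IH: "int (card (reps D (int m))) = w * divisor_sum f m" using less.IH m0 by blast
    have IH': "int (if int p dvd int m then card (reps D (int m div int p)) else 0)
       = w * (if p dvd m then divisor_sum f (m div p) else 0)"
    proof (cases "p dvd m")
      case True
      then have "m div p > 0" "m div p < n" using m0 p1 dvd_imp_le[of p m] le_less_trans[OF div_le_dividend[of m p]]
        by (auto simp: div_greater_zero_iff)
      then have "int (card (reps D (int (m div p)))) = w * divisor_sum f (m div p)" using less.IH by blast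
      then show ?thesis using True by (simp add: zdiv_int)
    qed simp
    note rec = divisor_sum_prime_mult[OF p(1) m0(1) mult]
    \<comment> \<open>The ramified, split and inert primes. For p = 2 the recurrence reduces to g (2
      m) = g m because \<open>f 2 = 0\<close>.\<close>
    consider "p = 2" | "p > 2" "f (int p) = 1" | "p > 2" "f (int p) = -1"
      using p1 range[of "int p"] prime_odd_nat[OF p(1)] by fastforce
    then show ?thesis
    proof cases
      case 1
      then show ?thesis using D IH rec two m card_reps_2_1 card_reps_2_2 by auto
    next
      case 2
      obtain a b where "a\<^sup>2 + D * b\<^sup>2 = int p"
        using prime_eq_square_plus[OF p(1) 2(1) _ D] QR[OF p(1) 2(1)] 2(2) by blast
      then have "int (card (reps D (int p * int m))) = 2 * int (card (reps D (int m)))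
        - int (if int p dvd int m then card (reps D (int m div int p)) else 0)"
        using p 2(1) by (intro card_reps_split_prime[OF _ _ _ D]) auto
      then show ?thesis unfolding IH IH' m rec 2(2) by (simp add: algebra_simps)
    next
      case 3
      then have "\<not> QuadRes (int p) (- D)" using QR p(1) by simp
      then have "int p dvd x \<and> int p dvd y" if "(x, y) \<in> reps D (int p * int m)" for x y
        using inert_prime_dvd[OF p(1), of D x y] that by (simp add: reps_def)
      then have "reps D (int p * int m) = {(x, y) \<in> reps D (int p * int m). int p dvd x \<and> int p dvd y}"
        by blast
      then have "int (card (reps D (int p * int m)))
         = int (if int p dvd int m then card (reps D (int m div int p)) else 0)"
        using card_reps_both_divisible[of "int p" D "int m"] p1 by simp
      then show ?thesis unfolding IH' m rec 3(2) by simp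
    qed
  qed
qed

lemma card_two_squares:
  assumes "n > 0"
  shows "int (card (reps 1 (int n))) = 4 * divisor_sum chi4 n"
proof (rule card_reps_eq_divisor_sum[OF _ chi4_mult chi4_1])
  show "odd a \<Longrightarrow> chi4 a = 1 \<or> chi4 a = - 1" for a unfolding chi4_def by presburger
  show "chi4 2 = 0" by (simp add: chi4_def)
  show "prime p \<Longrightarrow> 2 < p \<Longrightarrow> QuadRes (int p) (- 1) \<longleftrightarrow> chi4 (int p) = 1" for p
    by (rule QuadRes_neg_one_iff)
qed (use assms card_reps_1 in auto)

lemma card_square_plus_2_square:
  assumes "n > 0"
  shows "int (card (reps 2 (int n))) = 2 * divisor_sum (\<lambda>k. chi4 k * chi8 k) n"
proof (rule card_reps_eq_divisor_sum)
  show "chi4 a * chi8 a = 1 \<or> chi4 a * chi8 a = - 1" if "odd a" for a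
  proof -
    have "a mod 4 = 1 \<or> a mod 4 = 3" "a mod 8 = 1 \<or> a mod 8 = 3 \<or> a mod 8 = 5 \<or> a mod 8 = 7"
      using that by presburger+
    then show ?thesis by (auto simp: chi4_def chi8_def)
  qed
  show "chi4 (a * b) * chi8 (a * b) = chi4 a * chi8 a * (chi4 b * chi8 b)" for a b
    by (simp add: chi4_mult chi8_mult)
  show "chi4 2 * chi8 2 = 0" by (simp add: chi4_def)
  show "prime p \<Longrightarrow> 2 < p \<Longrightarrow> QuadRes (int p) (- 2) \<longleftrightarrow> chi4 (int p) * chi8 (int p) = 1" for p
    by (rule QuadRes_neg_two_iff)
qed (use assms card_reps_1 in auto)

subsection \<open>Liouville's identity\<close>

definition pos_divs :: "int \<Rightarrow> int set" where
  "pos_divs n = {d. 0 < d \<and> d dvd n}"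

text \<open>The index set of Liouville's method: all splittings of n into two positive parts, each
  with a divisor (a or b) and its cofactor (x or y).\<close>

definition quads :: "int \<Rightarrow> (int \<times> int \<times> int \<times> int) set" where
  "quads n = {(a, x, b, y). 0 < a \<and> 0 < x \<and> 0 < b \<and> 0 < y \<and> a * x + b * y = n}"

lemma divisor_sum_pos_divs: "n > 0 \<Longrightarrow> (\<Sum>d\<in>pos_divs (int n). f d) = divisor_sum f n"
  unfolding divisor_sum_def
  by (rule sum.reindex_bij_witness[of _ int nat])
    (auto simp: pos_divs_def int_dvd_int_iff nat_dvd_iff dvd_pos_nat)

lemma finite_pos_divs: "n > 0 \<Longrightarrow> finite (pos_divs n)"
  by (rule finite_subset[of _ "{0..n}"]) (auto simp: pos_divs_def zdvd_imp_le)

lemma finite_quads: "finite (quads n)"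
proof (rule finite_subset)
  show "quads n \<subseteq> {0..n} \<times> {0..n} \<times> {0..n} \<times> {0..n}"
  proof (rule subsetI)
    fix q assume "q \<in> quads n"
    then obtain a x b y
      where q: "q = (a, x, b, y)" and *: "0 < a" "0 < x" "0 < b" "0 < y" "a * x + b * y = n"
      by (auto simp: quads_def)
    have "a * 1 \<le> a * x" "1 * x \<le> a * x" "b * 1 \<le> b * y" "1 * y \<le> b * y"
      using * by (intro mult_left_mono mult_right_mono; simp)+
    moreover have "0 < a * x" "0 < b * y" using * by simp_all
    ultimately have "a \<le> n" "x \<le> n" "b \<le> n" "y \<le> n" using *(5) by linarith+
    then show "q \<in> {0..n} \<times> {0..n} \<times> {0..n} \<times> {0..n}"
      using * by (simp add: q)
  qed
qed simp

lemma quads_swap_sum: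
  "(\<Sum>(a, x, b, y)\<in>quads n. f a x b y) = (\<Sum>(a, x, b, y)\<in>quads n. f b y a x)"
  by (rule sum.reindex_bij_witness[of _ "\<lambda>(a, x, b, y). (b, y, a, x)" "\<lambda>(a, x, b, y). (b, y, a, x)"])
    (auto simp: quads_def)

text \<open>Terms with a = b vanish, and evenness of F makes those with a < b a copy of those with b
  < a. On the latter, a x + b y = (a - b) x + b (x + y) turns the difference into a first entry,
  with the cofactors in increasing order.\<close>

lemma quads_sum_difference:
  fixes F :: "int \<Rightarrow> int"
  assumes even: "\<And>k. F (- k) = F k" and zero: "F 0 = 0"
  shows "(\<Sum>(a, x, b, y)\<in>quads n. F (a - b)) = 2 * (\<Sum>(a, x, b, y)\<in>{(a, x, b, y)\<in>quads n. x < y}. F a)"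
proof -
  let ?Q = "quads n"
  let ?A = "{(a, x, b, y)\<in>?Q. b < a}" and ?B = "{(a, x, b, y)\<in>?Q. a < b}"
  have "(\<Sum>(a, x, b, y)\<in>?Q. F (a - b)) = (\<Sum>(a, x, b, y)\<in>?A \<union> ?B. F (a - b))"
    using zero by (intro sum.mono_neutral_right finite_quads) (auto simp: not_less order_less_le)
  also have "\<dots> = (\<Sum>(a, x, b, y)\<in>?A. F (a - b)) + (\<Sum>(a, x, b, y)\<in>?B. F (a - b))"
    by (intro sum.union_disjoint) (auto intro: finite_subset[OF _ finite_quads[of n]])
  also have "(\<Sum>(a, x, b, y)\<in>?B. F (a - b)) = (\<Sum>(a, x, b, y)\<in>?A. F (a - b))"
    by (rule sum.reindex_bij_witness[of _ "\<lambda>(a, x, b, y). (b, y, a, x)" "\<lambda>(a, x, b, y). (b, y, a, x)"])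
      (auto simp: quads_def even[of "_ - _", simplified])
  also have "(\<Sum>(a, x, b, y)\<in>?A. F (a - b)) = (\<Sum>(a, x, b, y)\<in>{(a, x, b, y)\<in>?Q. x < y}. F a)"
    by (rule sum.reindex_bij_witness[of _ "\<lambda>(a, x, b, y). (a + b, x, b, y - x)"
          "\<lambda>(a, x, b, y). (a - b, x, b, x + y)"])
      (auto simp: quads_def algebra_simps)
  finally show ?thesis by simp
qed

text \<open>For y < x, the identity a x + b y = (a + b) y + a (x - y) turns the sum into a first
  entry. The case x < y is symmetric, and x = y is left over.\<close>

lemma quads_sum_plus:
  fixes F :: "int \<Rightarrow> int"
  shows "(\<Sum>(a, x, b, y)\<in>quads n. F (a + b)) = 2 * (\<Sum>(a, x, b, y)\<in>{(a, x, b, y)\<in>quads n. b < a}. F a)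
    + (\<Sum>(a, x, b, y)\<in>{(a, x, b, y)\<in>quads n. x = y}. F (a + b))"
proof -
  let ?Q = "quads n"
  let ?A = "{(a, x, b, y)\<in>?Q. y < x}" and ?B = "{(a, x, b, y)\<in>?Q. x < y}" and ?C = "{(a, x, b, y)\<in>?Q. x = y}"
  note fin = finite_subset[OF _ finite_quads[of n]]
  have "?Q = (?A \<union> ?B) \<union> ?C" by auto
  then have "(\<Sum>(a, x, b, y)\<in>?Q. F (a + b)) = (\<Sum>(a, x, b, y)\<in>(?A \<union> ?B) \<union> ?C. F (a + b))" by simp
  also have "\<dots> = (\<Sum>(a, x, b, y)\<in>?A \<union> ?B. F (a + b)) + (\<Sum>(a, x, b, y)\<in>?C. F (a + b))"
    by (intro sum.union_disjoint) (auto intro: fin)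
  also have "(\<Sum>(a, x, b, y)\<in>?A \<union> ?B. F (a + b)) = (\<Sum>(a, x, b, y)\<in>?A. F (a + b)) + (\<Sum>(a, x, b, y)\<in>?B. F (a + b))"
    by (intro sum.union_disjoint) (auto intro: fin)
  also have "(\<Sum>(a, x, b, y)\<in>?B. F (a + b)) = (\<Sum>(a, x, b, y)\<in>?A. F (a + b))"
    by (rule sum.reindex_bij_witness[of _ "\<lambda>(a, x, b, y). (b, y, a, x)" "\<lambda>(a, x, b, y). (b, y, a, x)"])
      (auto simp: quads_def add.commute)
  also have "(\<Sum>(a, x, b, y)\<in>?A. F (a + b)) = (\<Sum>(a, x, b, y)\<in>{(a, x, b, y)\<in>?Q. b < a}. F a)"
    by (rule sum.reindex_bij_witness[of _ "\<lambda>(k, y, a, w). (a, w + y, k - a, y)"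
          "\<lambda>(a, x, b, y). (a + b, y, a, x - y)"])
      (auto simp: quads_def algebra_simps)
  finally show ?thesis by simp
qed

text \<open>The full sum of F a is split in two ways, by comparing x with y and by comparing a with
  b. The parts y < x and a < b agree, since a x + b y = a (x + y) + (b - a) y; only the two
  diagonals differ.\<close>

lemma quads_sum_compare:
  fixes F :: "int \<Rightarrow> int"
  shows "(\<Sum>(a, x, b, y)\<in>{(a, x, b, y)\<in>quads n. x < y}. F a) - (\<Sum>(a, x, b, y)\<in>{(a, x, b, y)\<in>quads n. b < a}. F a)
    = (\<Sum>(a, x, b, y)\<in>{(a, x, b, y)\<in>quads n. a = b}. F a) - (\<Sum>(a, x, b, y)\<in>{(a, x, b, y)\<in>quads n. x = y}. F a)"
proof -
  let ?Q = "quads n"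
  let ?s = "\<lambda>A. \<Sum>(a, x, b, y)\<in>A. F a"
  let ?A = "{(a, x, b, y)\<in>?Q. y < x}" and ?B = "{(a, x, b, y)\<in>?Q. x < y}" and ?C = "{(a, x, b, y)\<in>?Q. x = y}"
  let ?D = "{(a, x, b, y)\<in>?Q. b < a}" and ?E = "{(a, x, b, y)\<in>?Q. a < b}" and ?G = "{(a, x, b, y)\<in>?Q. a = b}"
  note fin = finite_subset[OF _ finite_quads[of n]]
  have *: "?s ((U \<union> V) \<union> W) = ?s U + ?s V + ?s W"
    if "U \<inter> V = {}" "(U \<union> V) \<inter> W = {}" "U \<subseteq> ?Q" "V \<subseteq> ?Q" "W \<subseteq> ?Q" for U V W
    using that by (simp add: sum.union_disjoint fin)
  have "?Q = (?A \<union> ?B) \<union> ?C" by auto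
  then have 1: "?s ?Q = ?s ?A + ?s ?B + ?s ?C" using *[of ?A ?B ?C] by fastforce
  have "?Q = (?D \<union> ?E) \<union> ?G" by auto
  then have 2: "?s ?Q = ?s ?D + ?s ?E + ?s ?G" using *[of ?D ?E ?G] by fastforce
  have "?s ?E = ?s ?A"
    by (rule sum.reindex_bij_witness[of _ "\<lambda>(a, x, b, y). (a, x - y, b + a, y)"
          "\<lambda>(a, x, b, y). (a, x + y, b - a, y)"])
      (auto simp: quads_def algebra_simps)
  then show ?thesis using 1 2 by linarith
qed

text \<open>For a = b = d the equation is x + y = n / d, with n / d - 1 positive solutions.\<close>

lemma quads_sum_diagonal:
  fixes F :: "int \<Rightarrow> int"
  assumes "n > 0"
  shows "(\<Sum>(a, x, b, y)\<in>{(a, x, b, y)\<in>quads n. a = b}. F a) = (\<Sum>d\<in>pos_divs n. (n div d - 1) * F d)"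
proof -
  have q: "n div d > 0" if "d \<in> pos_divs n" for d
    using that assms by (auto simp: pos_divs_def pos_imp_zdiv_pos_iff zdvd_imp_le)
  have "(\<Sum>d\<in>pos_divs n. (n div d - 1) * F d) = (\<Sum>d\<in>pos_divs n. \<Sum>x\<in>{0<..<n div d}. F d)"
    using q by (intro sum.cong refl) (simp add: zero_less_iff_neq_zero)
  also have "\<dots> = (\<Sum>(d, x)\<in>Sigma (pos_divs n) (\<lambda>d. {0<..<n div d}). F d)"
    using assms by (intro sum.Sigma) (simp_all add: finite_pos_divs)
  also have "\<dots> = (\<Sum>(a, x, b, y)\<in>{(a, x, b, y)\<in>quads n. a = b}. F a)"
    by (rule sum.reindex_bij_witness[of _ "\<lambda>(a, x, b, y). (a, x)" "\<lambda>(d, x). (d, x, d, n div d - x)"])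
      (auto simp: quads_def pos_divs_def algebra_simps simp flip: distrib_left)
  finally show ?thesis by simp
qed

lemma quads_sum_equal_cofactors:
  fixes F :: "int \<Rightarrow> int \<Rightarrow> int"
  assumes "n > 0"
  shows "(\<Sum>(a, x, b, y)\<in>{(a, x, b, y)\<in>quads n. x = y}. F a b) = (\<Sum>d\<in>pos_divs n. \<Sum>k\<in>{0<..<d}. F k (d - k))"
proof -
  have "(\<Sum>d\<in>pos_divs n. \<Sum>k\<in>{0<..<d}. F k (d - k)) = (\<Sum>(d, k)\<in>Sigma (pos_divs n) (\<lambda>d. {0<..<d}). F k (d - k))"
    using assms by (intro sum.Sigma) (simp_all add: finite_pos_divs)
  also have "\<dots> = (\<Sum>(a, x, b, y)\<in>{(a, x, b, y)\<in>quads n. x = y}. F a b)"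
    by (rule sum.reindex_bij_witness[of _ "\<lambda>(a, x, b, y). (a + b, a)" "\<lambda>(d, k). (k, n div d, d - k, n div d)"])
      (use assms in \<open>auto simp: quads_def pos_divs_def pos_imp_zdiv_pos_iff zdvd_imp_le simp flip: distrib_right\<close>)
  finally show ?thesis by simp
qed

text \<open>The off-diagonal parts of the sums of F (a - b) and F (a + b) differ by diagonal sums
  only (\<open>quads_sum_compare\<close>), and these run over the divisors of n.\<close>

lemma liouville_identity:
  fixes F :: "int \<Rightarrow> int"
  assumes "\<And>k. F (- k) = F k" and "F 0 = 0" and n: "n > 0"
  shows "(\<Sum>(a, x, b, y)\<in>quads n. F (a - b) - F (a + b))
    = (\<Sum>d\<in>pos_divs n. (2 * (n div d) - 1 - d) * F d - 2 * (\<Sum>k\<in>{0<..<d}. F k))"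
proof -
  let ?s = "\<lambda>f. \<Sum>d\<in>pos_divs n. f d"
  have "(\<Sum>d\<in>pos_divs n. \<Sum>k\<in>{0<..<d}. F (k + (d - k))) = ?s (\<lambda>d. (d - 1) * F d)"
    by (intro sum.cong refl) (simp add: pos_divs_def)
  then have "(\<Sum>(a, x, b, y)\<in>quads n. F (a - b) - F (a + b))
    = 2 * ?s (\<lambda>d. (n div d - 1) * F d) - 2 * ?s (\<lambda>d. \<Sum>k\<in>{0<..<d}. F k) - ?s (\<lambda>d. (d - 1) * F d)"
    using quads_sum_difference[OF assms(1,2), of n] quads_sum_plus[of F n] quads_sum_compare[of F n]
      quads_sum_diagonal[OF n, of F] quads_sum_equal_cofactors[OF n, of "\<lambda>a b. F (a + b)"]
      quads_sum_equal_cofactors[OF n, of "\<lambda>a b. F a"]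
    by (simp add: sum_subtractf case_prod_unfold)
  also have "\<dots> = ?s (\<lambda>d. 2 * ((n div d - 1) * F d) - 2 * (\<Sum>k\<in>{0<..<d}. F k) - (d - 1) * F d)"
    by (simp add: sum_subtractf sum_distrib_left)
  finally show ?thesis by (simp add: algebra_simps)
qed

subsection \<open>Representations by \<open>x\<^sup>2 + 2 y\<^sup>2 + 8 u\<^sup>2 + 8 v\<^sup>2\<close>\<close>

text \<open>Extension by zero to odd arguments, so that \<open>chi8_minus_plus\<close> holds without
  parity cases.\<close>

definition half_chi4 :: "int \<Rightarrow> int" where
  "half_chi4 a = (if even a then chi4 (a div 2) else 0)"

text \<open>Both sides have period 8 in a and in b, so 64 cases suffice. As with cos (a - b) - cos
  (a + b), the point is to separate the variables, so that Liouville's left side becomes a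
  convolution.\<close>

lemma chi8_minus_plus:
  "chi8 (a - b) - chi8 (a + b) = 2 * half_chi4 a * (chi4 b * chi8 b) + 2 * half_chi4 b * (chi4 a * chi8 a)"
proof -
  have *: "\<forall>r\<in>{0,1,2,3,4,5,6,7}. \<forall>s\<in>{0,1,2,3,4,5,6,7}. chi8 (r - s) - chi8 (r + s)
      = 2 * half_chi4 r * (chi4 s * chi8 s) + 2 * half_chi4 s * (chi4 r * chi8 r)"
    by (simp add: chi8_def chi4_def half_chi4_def)
  have m: "a mod 8 \<in> {0,1,2,3,4,5,6,7}" "b mod 8 \<in> {0,1,2,3,4,5,6,7}"
    unfolding insert_iff empty_iff by presburger+
  have "chi8 (a mod 8 - b mod 8) - chi8 (a mod 8 + b mod 8)
      = 2 * half_chi4 (a mod 8) * (chi4 (b mod 8) * chi8 (b mod 8))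
        + 2 * half_chi4 (b mod 8) * (chi4 (a mod 8) * chi8 (a mod 8))"
    by (rule bspec[OF bspec[OF * m(1)] m(2)])
  moreover have "chi8 (a mod 8 - b mod 8) = chi8 (a - b)" "chi8 (a mod 8 + b mod 8) = chi8 (a + b)"
    by (rule chi8_cong, simp add: mod_diff_eq mod_add_eq)+
  moreover have "chi8 (x mod 8) = chi8 x" "chi4 (x mod 8) = chi4 x" for x
    by (rule chi8_cong, simp, rule chi4_cong, simp add: mod_mod_cancel)
  moreover have "half_chi4 (x mod 8) = half_chi4 x" for x
  proof (cases "even x")
    case True
    then have "even (x mod 8)" "x mod 8 div 2 mod 4 = x div 2 mod 4" by presburger+
    then show ?thesis using True chi4_cong[of "x mod 8 div 2" "x div 2"] by (simp only: half_chi4_def if_True)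
  next
    case False
    then have "odd (x mod 8)" by presburger
    then show ?thesis using False by (simp add: half_chi4_def)
  qed
  ultimately show ?thesis by (simp only:)
qed

text \<open>Induction in steps of 2: passing from e to e + 2 adds only chi8 e, as chi8 vanishes at
  even numbers, and the right side changes by twice that amount in each class modulo 8.\<close>

lemma sum_chi8_below:
  assumes "odd d" "d > 0"
  shows "2 * (\<Sum>k\<in>{0<..<d}. chi8 k) = chi4 d * chi8 d - chi8 d"
proof -
  have "2 * (\<Sum>k\<in>{0<..<2 * int m + 1}. chi8 k)
      = chi4 (2 * int m + 1) * chi8 (2 * int m + 1) - chi8 (2 * int m + 1)" for m
  proof (induction m)
    case (Suc m)
    define e where "e = 2 * int m + 1"
    have e: "2 * int (Suc m) + 1 = e + 2" "e > 0" "odd e" by (simp_all add: e_def)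
    have "{0<..<e + 2} = insert e (insert (e + 1) {0<..<e})" using e by auto
    then have "(\<Sum>k\<in>{0<..<e + 2}. chi8 k) = chi8 e + chi8 (e + 1) + (\<Sum>k\<in>{0<..<e}. chi8 k)"
      by simp
    moreover have "e mod 8 = 1 \<or> e mod 8 = 3 \<or> e mod 8 = 5 \<or> e mod 8 = 7" using e(3) by presburger
    then have "2 * chi8 (e + 1) = 0 \<and> 2 * chi8 e + chi4 e * chi8 e - chi8 e = chi4 (e + 2) * chi8 (e + 2) - chi8 (e + 2)"
    proof (elim disjE)
      assume "e mod 8 = 1"
      moreover from this have "e mod 4 = 1" "(e + 2) mod 8 = 3" "(e + 2) mod 4 = 3" "(e + 1) mod 8 = 2" by presburger+
      ultimately show ?thesis by (simp add: chi4_def chi8_def)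
    next
      assume "e mod 8 = 3"
      moreover from this have "e mod 4 = 3" "(e + 2) mod 8 = 5" "(e + 2) mod 4 = 1" "(e + 1) mod 8 = 4" by presburger+
      ultimately show ?thesis by (simp add: chi4_def chi8_def)
    next
      assume "e mod 8 = 5"
      moreover from this have "e mod 4 = 1" "(e + 2) mod 8 = 7" "(e + 2) mod 4 = 3" "(e + 1) mod 8 = 6" by presburger+
      ultimately show ?thesis by (simp add: chi4_def chi8_def)
    next
      assume "e mod 8 = 7"
      moreover from this have "e mod 4 = 3" "(e + 2) mod 8 = 1" "(e + 2) mod 4 = 1" "(e + 1) mod 8 = 0" by presburger+
      ultimately show ?thesis by (simp add: chi4_def chi8_def)
    qed
    ultimately show ?case using Suc unfolding e(1) e_def[symmetric] by simp
  next
    case 0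
    have "{0<..<1::int} = {}" by auto
    then show ?case by simp
  qed
  moreover obtain m where "d = 2 * int m + 1"
  proof -
    obtain c where c: "d = 2 * c + 1" using assms(1) by (rule oddE)
    then have "c \<ge> 0" using assms(2) by simp
    then show thesis using c that nonneg_int_cases by metis
  qed
  ultimately show ?thesis by simp
qed

text \<open>Only even a = 2 d contribute. With k = d x the equation reads b y = n - 2 k, so d and b
  run over the divisors of k and of n - 2 k.\<close>

lemma quads_half_chi4_sum:
  fixes n :: nat and f :: "int \<Rightarrow> int"
  assumes "n > 0"
  shows "(\<Sum>(a, x, b, y)\<in>quads (int n). half_chi4 a * f b)
    = (\<Sum>k\<in>{k. 0 < k \<and> 2 * k < n}. divisor_sum chi4 k * divisor_sum f (n - 2 * k))"
proof -
  let ?K = "{k. 0 < k \<and> 2 * k < n}"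
  have finK: "finite ?K" by (rule finite_subset[of _ "{..n}"]) auto
  have "(\<Sum>k\<in>?K. divisor_sum chi4 k * divisor_sum f (n - 2 * k))
    = (\<Sum>k\<in>?K. (\<Sum>d\<in>pos_divs (int k). chi4 d) * (\<Sum>e\<in>pos_divs (int n - 2 * int k). f e))"
  proof (rule sum.cong[OF refl])
    fix k assume "k \<in> ?K"
    then show "divisor_sum chi4 k * divisor_sum f (n - 2 * k)
      = (\<Sum>d\<in>pos_divs (int k). chi4 d) * (\<Sum>e\<in>pos_divs (int n - 2 * int k). f e)"
      using divisor_sum_pos_divs[of k chi4] divisor_sum_pos_divs[of "n - 2 * k" f]
      by (simp add: of_nat_diff)
  qed
  also have "\<dots> = (\<Sum>k\<in>?K. \<Sum>(d, e)\<in>pos_divs (int k) \<times> pos_divs (int n - 2 * int k). chi4 d * f e)"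
    by (simp add: sum_product sum.cartesian_product)
  also have "\<dots> = (\<Sum>(k, d, e)\<in>Sigma ?K (\<lambda>k. pos_divs (int k) \<times> pos_divs (int n - 2 * int k)). chi4 d * f e)"
    using finK by (subst sum.Sigma) (auto simp: finite_pos_divs)
  also have "\<dots> = (\<Sum>(a, x, b, y)\<in>{(a, x, b, y)\<in>quads (int n). even a}. half_chi4 a * f b)"
  proof (rule sum.reindex_bij_witness[of _ "\<lambda>(a, x, b, y). (nat (a * x div 2), a div 2, b)"
        "\<lambda>(k, d, e). (2 * d, int k div d, e, (int n - 2 * int k) div e)"], goal_cases)
    case (1 w)
    then obtain k d e where w: "w = (k, d, e)" "0 < k" "0 < d" "d dvd int k" by (auto simp: pos_divs_def)
    then show ?case by simp
  next
    case (2 w)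
    then obtain k d e where w: "w = (k, d, e)" "0 < k" "2 * k < n" "0 < d" "d dvd int k"
      "0 < e" "e dvd int n - 2 * int k" by (auto simp: pos_divs_def)
    then have "0 < int k div d" "0 < (int n - 2 * int k) div e"
      by (simp_all add: pos_imp_zdiv_pos_iff zdvd_imp_le)
    then show ?case using w by (simp add: quads_def)
  next
    case (3 w)
    then obtain d x b y where w: "w = (2 * d, x, b, y)" "0 < d" "0 < x" "0 < b" "0 < y" "2 * d * x + b * y = int n"
      by (auto simp: quads_def elim!: evenE)
    then have "int n - 2 * (d * x) = b * y" by simp
    then show ?case using w(1-5) by simp
  next
    case (4 w)
    then obtain d x b y where w: "w = (2 * d, x, b, y)" "0 < d" "0 < x" "0 < b" "0 < y" "2 * d * x + b * y = int n"
      by (auto simp: quads_def elim!: evenE)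
    then have "int n - 2 * (d * x) = b * y" "0 < d * x" "0 < b * y" by simp_all
    note pos = this
    define k where "k = nat (d * x)"
    have k: "int k = d * x" using pos(2) by (simp add: k_def)
    then have "int n - 2 * int k = b * y" "0 < k" "2 * k < n" using pos by linarith+
    then show ?case using w(1-5) k by (simp add: pos_divs_def flip: k_def)
  next
    case (5 w)
    then show ?case by (auto simp: half_chi4_def)
  qed
  also have "\<dots> = (\<Sum>(a, x, b, y)\<in>quads (int n). half_chi4 a * f b)"
    by (rule sum.mono_neutral_left) (auto simp: finite_quads half_chi4_def split: if_splits)
  finally show ?thesis by simp
qed

text \<open>Liouville's identity for F = chi8: the two terms of \<open>chi8_minus_plus\<close> have
  equal sums by symmetry. All divisors of n are odd, so \<open>sum_chi8_below\<close> evaluates the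
  inner sums.\<close>

lemma chi4_chi8_convolution:
  fixes n :: nat
  assumes "odd n"
  shows "4 * (\<Sum>k\<in>{k. 0 < k \<and> 2 * k < n}. divisor_sum chi4 k * divisor_sum (\<lambda>d. chi4 d * chi8 d) (n - 2 * k))
    = divisor_sum (\<lambda>d. (2 * (int n div d) - d) * chi8 d) n - divisor_sum (\<lambda>d. chi4 d * chi8 d) n"
proof -
  let ?f = "\<lambda>d. chi4 d * chi8 d"
  have n: "n > 0" using assms by (cases n) auto
  have "(\<Sum>(a, x, b, y)\<in>quads (int n). chi8 (a - b) - chi8 (a + b))
    = (\<Sum>(a, x, b, y)\<in>quads (int n). 2 * (half_chi4 a * ?f b)) + (\<Sum>(a, x, b, y)\<in>quads (int n). 2 * (half_chi4 b * ?f a))"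
    unfolding sum.distrib[symmetric] by (intro sum.cong refl) (auto simp: chi8_minus_plus)
  also have "(\<Sum>(a, x, b, y)\<in>quads (int n). 2 * (half_chi4 b * ?f a)) = (\<Sum>(a, x, b, y)\<in>quads (int n). 2 * (half_chi4 a * ?f b))"
    by (rule quads_swap_sum)
  finally have "(\<Sum>(a, x, b, y)\<in>quads (int n). chi8 (a - b) - chi8 (a + b))
    = 4 * (\<Sum>(a, x, b, y)\<in>quads (int n). half_chi4 a * ?f b)"
    by (simp add: sum_distrib_left case_prod_unfold)
  moreover have "(\<Sum>(a, x, b, y)\<in>quads (int n). chi8 (a - b) - chi8 (a + b))
    = (\<Sum>d\<in>pos_divs (int n). (2 * (int n div d) - 1 - d) * chi8 d - 2 * (\<Sum>k\<in>{0<..<d}. chi8 k))"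
    using n by (intro liouville_identity) (auto simp: chi8_minus chi8_def[of 0])
  moreover have "\<dots> = (\<Sum>d\<in>pos_divs (int n). (2 * (int n div d) - d) * chi8 d - ?f d)"
  proof (rule sum.cong[OF refl])
    fix d assume "d \<in> pos_divs (int n)"
    then have "odd d" "d > 0"
      using assms dvd_trans[of 2 d "int n"] by (auto simp: pos_divs_def)
    then show "(2 * (int n div d) - 1 - d) * chi8 d - 2 * (\<Sum>k\<in>{0<..<d}. chi8 k) = (2 * (int n div d) - d) * chi8 d - ?f d"
      using sum_chi8_below by (simp add: algebra_simps)
  qed
  ultimately show ?thesis
    using n by (simp add: quads_half_chi4_sum sum_subtractf divisor_sum_pos_divs)
qed

section \<open>Counting by the quaternary forms\<close>

lemma card_reps_1_0: "card (reps 1 0) = 1"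
proof -
  have "reps 1 0 = {(0, 0)}" by (auto simp: reps_def sum_power2_eq_zero_iff)
  then show ?thesis by simp
qed

definition reps4 :: "int \<Rightarrow> int \<Rightarrow> (int \<times> int \<times> int \<times> int) set" where
  "reps4 c k = {(x, y, u, v). x\<^sup>2 + 2 * y\<^sup>2 + c * u\<^sup>2 + c * v\<^sup>2 = k}"

lemma finite_reps4:
  assumes "c \<ge> 1"
  shows "finite (reps4 c k)"
proof (rule finite_subset)
  show "reps4 c k \<subseteq> {-k..k} \<times> {-k..k} \<times> {-k..k} \<times> {-k..k}"
  proof (rule subsetI)
    fix q assume "q \<in> reps4 c k"
    then obtain x y u v where q: "q = (x, y, u, v)" "x\<^sup>2 + 2 * y\<^sup>2 + c * u\<^sup>2 + c * v\<^sup>2 = k"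
      by (auto simp: reps4_def)
    have "u\<^sup>2 \<le> c * u\<^sup>2" "v\<^sup>2 \<le> c * v\<^sup>2" using assms by (simp_all add: mult_le_cancel_right1)
    moreover have "\<bar>z\<bar> \<le> z\<^sup>2" "0 \<le> z\<^sup>2" for z :: int using abs_le_square_int by simp_all
    note this[of x] this[of y] this[of u] this[of v]
    ultimately have "\<bar>x\<bar> \<le> k" "\<bar>y\<bar> \<le> k" "\<bar>u\<bar> \<le> k" "\<bar>v\<bar> \<le> k"
      using q(2) by linarith+
    then show "q \<in> {-k..k} \<times> {-k..k} \<times> {-k..k} \<times> {-k..k}" unfolding q(1) by auto
  qed
qed simp

text \<open>Group by k = u^2 + v^2. The terms with k > 0 form the convolution, and the term k = 0
  cancels the last divisor sum in \<open>chi4_chi8_convolution\<close>.\<close>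

lemma card_reps4_2:
  fixes n :: nat
  assumes "odd n"
  shows "int (card (reps4 2 (int n))) = 2 * divisor_sum (\<lambda>d. (2 * (int n div d) - d) * chi8 d) n"
proof -
  let ?f = "\<lambda>d. chi4 d * chi8 d"
  let ?K = "{k. 0 < k \<and> 2 * k < n}"
  have n: "n > 0" using assms by (cases n) auto
  have K: "{k. 2 * k < n} = insert 0 ?K" using n by auto
  have finK: "finite ?K" by (rule finite_subset[of _ "{..n}"]) auto
  have "bij_betw (\<lambda>(x, y, u, v). (nat (u\<^sup>2 + v\<^sup>2), (u, v), (x, y))) (reps4 2 (int n))
     (Sigma {k. 2 * k < n} (\<lambda>k. reps 1 (int k) \<times> reps 2 (int n - 2 * int k)))"
  proof (rule bij_betw_byWitness[where f' = "\<lambda>(k, (u, v), (x, y)). (x, y, u, v)"])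
    show "(\<lambda>(x, y, u, v). (nat (u\<^sup>2 + v\<^sup>2), (u, v), (x, y))) ` reps4 2 (int n)
      \<subseteq> (Sigma {k. 2 * k < n} (\<lambda>k. reps 1 (int k) \<times> reps 2 (int n - 2 * int k)))"
    proof (rule image_subsetI)
      fix q assume "q \<in> reps4 2 (int n)"
      then obtain x y u v where q: "q = (x, y, u, v)" "x\<^sup>2 + 2 * y\<^sup>2 + 2 * u\<^sup>2 + 2 * v\<^sup>2 = int n"
        by (auto simp: reps4_def)
      define k where "k = nat (u\<^sup>2 + v\<^sup>2)"
      have k: "int k = u\<^sup>2 + v\<^sup>2" by (simp add: k_def)
      have "2 * int k \<le> int n" using q(2) zero_le_power2[of x] zero_le_power2[of y] k by linarith
      \<comment> \<open>Oddness of n excludes 2 k = n, so the divisor formula applies to n - 2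
        k.\<close>
      then have "2 * k < n" using assms by presburger
      then show "(case q of (x, y, u, v) \<Rightarrow> (nat (u\<^sup>2 + v\<^sup>2), (u, v), (x, y)))
        \<in> (Sigma {k. 2 * k < n} (\<lambda>k. reps 1 (int k) \<times> reps 2 (int n - 2 * int k)))"
        using q(2) k by (simp add: q(1) reps_def flip: k_def)
    qed
  qed (auto simp: reps4_def reps_def)
  then have "card (reps4 2 (int n)) = card (Sigma {k. 2 * k < n} (\<lambda>k. reps 1 (int k) \<times> reps 2 (int n - 2 * int k)))"
    by (rule bij_betw_same_card)
  also have "\<dots> = (\<Sum>k\<in>{k. 2 * k < n}. card (reps 1 (int k)) * card (reps 2 (int n - 2 * int k)))"
    using finK unfolding K by (subst card_SigmaI) (auto simp: finite_reps card_cartesian_product)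
  also have "int \<dots> = int (card (reps 2 (int n)))
      + (\<Sum>k\<in>?K. int (card (reps 1 (int k))) * int (card (reps 2 (int n - 2 * int k))))"
    using finK unfolding K by (simp add: card_reps_1_0)
  also have "(\<Sum>k\<in>?K. int (card (reps 1 (int k))) * int (card (reps 2 (int n - 2 * int k))))
      = (\<Sum>k\<in>?K. 8 * (divisor_sum chi4 k * divisor_sum ?f (n - 2 * k)))"
  proof (rule sum.cong[OF refl])
    fix k assume "k \<in> ?K"
    then have k: "0 < k" "2 * k < n" by simp_all
    then have "int (n - 2 * k) = int n - 2 * int k" by (simp add: of_nat_diff)
    then have "int (card (reps 1 (int k))) = 4 * divisor_sum chi4 k"
      "int (card (reps 2 (int n - 2 * int k))) = 2 * divisor_sum ?f (n - 2 * k)"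
      using k card_two_squares[of k] card_square_plus_2_square[of "n - 2 * k"] by simp_all
    then show "int (card (reps 1 (int k))) * int (card (reps 2 (int n - 2 * int k)))
        = 8 * (divisor_sum chi4 k * divisor_sum ?f (n - 2 * k))" by simp
  qed
  also have "\<dots> = 2 * (4 * (\<Sum>k\<in>?K. divisor_sum chi4 k * divisor_sum ?f (n - 2 * k)))"
    by (simp add: sum_distrib_left)
  finally show ?thesis
    unfolding chi4_chi8_convolution[OF assms] card_square_plus_2_square[OF n] by simp
qed

lemma odd_square_mod_8: "odd (x::int) \<Longrightarrow> x\<^sup>2 mod 8 = 1"
proof -
  assume "odd x"
  then obtain m where "x = 2 * m + 1" by (rule oddE)
  then have "x\<^sup>2 = 4 * (m * (m + 1)) + 1" by (simp add: algebra_simps power2_eq_square)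
  moreover have "even (m * (m + 1))" by simp
  then obtain j where "m * (m + 1) = 2 * j" by (rule evenE)
  ultimately show ?thesis by simp
qed

lemma even_square_mod_4: "even (x::int) \<Longrightarrow> x\<^sup>2 mod 4 = 0"
  by (auto elim!: evenE simp: power_mult_distrib)

text \<open>Here x is odd, so y^2 + u^2 + v^2 is 1 modulo 4 and exactly one of y, u, v is odd.
  Exchanging variables shows that the three classes have equal size; in the class with y odd, u and
  v can be halved.\<close>

lemma card_reps4_8:
  fixes n :: nat
  assumes n: "n mod 8 = 3"
  shows "3 * card (reps4 8 (int n)) = card (reps4 2 (int n))"
proof -
  define Ry where "Ry = {(x, y, u, v) \<in> reps4 2 (int n). odd y \<and> even u \<and> even v}"
  define Ru where "Ru = {(x, y, u, v) \<in> reps4 2 (int n). even y \<and> odd u \<and> even v}"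
  define Rv where "Rv = {(x, y, u, v) \<in> reps4 2 (int n). even y \<and> even u \<and> odd v}"
  have n8: "int n mod 8 = 3" using n by presburger
  have odd_iff: "odd z \<longleftrightarrow> z\<^sup>2 mod 4 = 1" "even z \<longleftrightarrow> z\<^sup>2 mod 4 = 0" for z :: int
  proof -
    have "A mod 8 = 1 \<Longrightarrow> A mod 4 = 1" for A :: int by presburger
    then have "odd z \<Longrightarrow> z\<^sup>2 mod 4 = 1" using odd_square_mod_8 by blast
    then show "odd z \<longleftrightarrow> z\<^sup>2 mod 4 = 1" "even z \<longleftrightarrow> z\<^sup>2 mod 4 = 0"
      using even_square_mod_4[of z] by (metis zero_neq_one)+
  qed
  have par: "(odd y \<and> even u \<and> even v) \<or> (even y \<and> odd u \<and> even v) \<or> (even y \<and> even u \<and> odd v)"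
    if q: "x\<^sup>2 + 2 * y\<^sup>2 + 2 * u\<^sup>2 + 2 * v\<^sup>2 = int n" for x y u v :: int
  proof -
    define T where "T = y\<^sup>2 + u\<^sup>2 + v\<^sup>2"
    define X where "X = x\<^sup>2"
    have X: "X + 2 * T = int n" using q by (simp add: T_def X_def)
    then have "odd X" using n8 by presburger
    then have "X mod 8 = 1" using odd_square_mod_8 by (simp add: X_def)
    then have "T mod 4 = 1" using X n8 by presburger
    then have "(y\<^sup>2 mod 4 + u\<^sup>2 mod 4 + v\<^sup>2 mod 4) mod 4 = 1"
      unfolding T_def by (metis mod_add_eq mod_mod_trivial)
    moreover have "z\<^sup>2 mod 4 = 0 \<or> z\<^sup>2 mod 4 = 1" for z :: int using odd_iff[of z] by blast
    note this[of y] this[of u] this[of v]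
    ultimately show ?thesis unfolding odd_iff by (elim disjE) simp_all
  qed
  then have "reps4 2 (int n) = Ry \<union> Ru \<union> Rv"
    unfolding Ry_def Ru_def Rv_def by (auto simp: reps4_def)
  moreover have "card (Ry \<union> Ru \<union> Rv) = card Ry + card Ru + card Rv"
  proof -
    have "finite Ry" "finite Ru" "finite Rv"
      unfolding Ry_def Ru_def Rv_def by (auto intro: finite_subset[OF _ finite_reps4[of 2 "int n"]])
    moreover have "Ry \<inter> Ru = {}" "(Ry \<union> Ru) \<inter> Rv = {}" unfolding Ry_def Ru_def Rv_def by auto
    ultimately show ?thesis by (simp add: card_Un_disjoint)
  qed
  moreover have "card Ry = card Ru"
    by (rule bij_betw_same_card[of "\<lambda>(x, y, u, v). (x, u, y, v)"],
        rule bij_betw_byWitness[where f' = "\<lambda>(x, y, u, v). (x, u, y, v)"])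
      (auto simp: Ry_def Ru_def reps4_def)
  moreover have "card Ry = card Rv"
    by (rule bij_betw_same_card[of "\<lambda>(x, y, u, v). (x, v, u, y)"],
        rule bij_betw_byWitness[where f' = "\<lambda>(x, y, u, v). (x, v, u, y)"])
      (auto simp: Ry_def Rv_def reps4_def)
  moreover have "card (reps4 8 (int n)) = card Ry"
  proof (rule bij_betw_same_card[of "\<lambda>(x, y, u, v). (x, y, 2 * u, 2 * v)"],
      rule bij_betw_byWitness[where f' = "\<lambda>(x, y, u, v). (x, y, u div 2, v div 2)"])
    have "odd y" if "x\<^sup>2 + 2 * y\<^sup>2 + 8 * u\<^sup>2 + 8 * v\<^sup>2 = int n" for x y u v :: int
      using par[of x y "2 * u" "2 * v"] that by (simp add: power_mult_distrib)
    then show "(\<lambda>(x, y, u, v). (x, y, 2 * u, 2 * v)) ` reps4 8 (int n) \<subseteq> Ry"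
      by (auto simp: Ry_def reps4_def power_mult_distrib)
    show "(\<lambda>(x, y, u, v). (x, y, u div 2, v div 2)) ` Ry \<subseteq> reps4 8 (int n)"
      by (auto simp: Ry_def reps4_def power_mult_distrib elim!: evenE)
  qed (auto simp: Ry_def)
  ultimately show ?thesis by simp
qed

text \<open>Since chi8 n = -1, passing to the complementary divisor changes the sign of chi8. So the
  sum of (n / d) chi8 d is minus that of d chi8 d, and the resulting factor -3 cancels the 3 of
  \<open>card_reps4_8\<close>.\<close>

lemma card_reps4_8_eq:
  fixes n :: nat
  assumes n: "n mod 8 = 3"
  shows "int (card (reps4 8 (int n))) = - 2 * (\<Sum>d | d dvd n. int d * chi8 (int d))"
proof -
  have odd: "odd n" using n by presburger
  then have n0: "n > 0" by (cases n) auto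
  have "divisor_sum (\<lambda>d. (int n div d) * chi8 d) n = (\<Sum>d | d dvd n. - (int d * chi8 (int d)))"
    unfolding divisor_sum_def
  proof (rule sum.reindex_bij_witness[of _ "\<lambda>d. n div d" "\<lambda>d. n div d"], goal_cases)
    case (5 d)
    then obtain e where e: "n = d * e" by auto
    then have d0: "d > 0" using n0 by simp
    have "chi8 (int n) = -1" using n by (simp add: chi8_def) presburger
    then have "chi8 (int d) * chi8 (int e) = -1" by (simp add: e chi8_mult)
    then have "chi8 (int e) = - chi8 (int d)" by (auto simp: chi8_def split: if_splits)
    then show ?case using d0 by (simp add: e)
  qed (use n0 in \<open>auto elim!: dvdE\<close>)
  then have "divisor_sum (\<lambda>d. (2 * (int n div d) - d) * chi8 d) n = - 3 * (\<Sum>d | d dvd n. int d * chi8 (int d))"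
    unfolding divisor_sum_def
    by (simp add: left_diff_distrib sum_subtractf mult.assoc sum_negf flip: sum_distrib_left)
  then show ?thesis using card_reps4_8[OF n] card_reps4_2[OF odd] by simp
qed

subsection \<open>An alternating sum over \<open>x\<^sup>2 + 8 u\<^sup>2 + 8 v\<^sup>2\<close>\<close>

definition sign :: "int \<Rightarrow> int" where
  "sign k = (if even k then 1 else -1)"

text \<open>A triple \<open>(x, y, z)\<close> stands for the quadratic form \<open>f (s, t) = y s\<^sup>2 + x s t - z t\<^sup>2\<close> of
  discriminant \<open>M\<close>; positivity of \<open>y\<close> and \<open>z\<close> says \<open>f (1, 0) > 0 > f (0, 1)\<close>. The involutions in
  the three cancellation lemmas below are substitutions (the third combined with \<open>f \<mapsto> - f\<close>), and
  their domains are told apart by the signs of \<open>f (1, -1) = y - x - z\<close> and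
  \<open>f (2, -1) = 4 y - 2 x - z\<close>. Only the forms with \<open>f (1, -1) = 0\<close> survive, and these have square
  discriminant.\<close>

definition crossing :: "int \<Rightarrow> (int \<times> int \<times> int) set" where
  "crossing M = {(x, y, z). 0 < y \<and> even y \<and> 0 < z \<and> odd z \<and> 4 dvd x - z \<and> x\<^sup>2 + 4 * y * z = M}"

text \<open>For y = 2 e and z = d, with d odd, this is the summand
  \<open>chi4 d * sign (d * e)\<close> of \<open>sum_crossing_unfold\<close>.\<close>

definition weight :: "int \<times> int \<times> int \<Rightarrow> int" where
  "weight = (\<lambda>(x, y, z). chi4 z * sign (y div 2))"

lemma sum_involution_zero:
  fixes f :: "'a \<Rightarrow> int"
  assumes "\<And>a. a \<in> A \<Longrightarrow> t a \<in> A" "\<And>a. a \<in> A \<Longrightarrow> t (t a) = a" "\<And>a. a \<in> A \<Longrightarrow> f (t a) = - f a"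
  shows "sum f A = 0"
proof -
  have "sum f A = (\<Sum>a\<in>A. - f a)"
    by (rule sum.reindex_bij_witness[of _ t t]) (use assms in auto)
  then show ?thesis by (simp add: sum_negf)
qed

lemma finite_crossing: "finite (crossing M)"
proof (rule finite_subset)
  show "crossing M \<subseteq> {-M..M} \<times> {0..M} \<times> {0..M}"
  proof (rule subsetI)
    fix q assume "q \<in> crossing M"
    then obtain x y z where q: "q = (x, y, z)" "0 < y" "0 < z" "x\<^sup>2 + 4 * y * z = M"
      by (auto simp: crossing_def)
    have "y * 1 \<le> y * z" "1 * z \<le> y * z" using q by (intro mult_left_mono mult_right_mono; simp)+
    moreover have "x\<^sup>2 + 4 * (y * z) = M" using q(4) by simp
    ultimately have "\<bar>x\<bar> \<le> M" "y \<le> M" "z \<le> M"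
      using abs_le_square_int[of x] zero_le_power2[of x] q(2,3) by linarith+
    then show "q \<in> {-M..M} \<times> {0..M} \<times> {0..M}" using q by auto
  qed
qed simp

lemma odd_crossing: "4 dvd x - z \<Longrightarrow> odd z \<Longrightarrow> odd (x::int)"
  by presburger

lemma weight_flip:
  assumes "even y" "chi4 z' = chi4 z" "4 dvd y' - y - 2"
  shows "weight (x', y', z') = - weight (x, y, z)"
proof -
  have "even (y' div 2) \<longleftrightarrow> odd (y div 2)" using assms(1,3) by presburger
  then show ?thesis using assms(2) by (simp add: weight_def sign_def)
qed

text \<open>The substitution (s, t) = (S, -S - T) keeps z and replaces y by f (1, -1). As x = z
  modulo 4 with z odd, x + z is 2 modulo 4, so y / 2 changes parity.\<close>

lemma crossing_cancel_1: "sum weight {(x, y, z) \<in> crossing M. x + z < y} = 0"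
proof (rule sum_involution_zero[where t = "\<lambda>(x, y, z). (- x - 2 * z, y - x - z, z)"], goal_cases)
  case (1 q)
  then obtain x y z where q: "q = (x, y, z)" "even y" "0 < y" "0 < z" "odd z" "4 dvd x - z" "x\<^sup>2 + 4 * y * z = M" "x + z < y"
    by (auto simp: crossing_def)
  have "odd x" using odd_crossing q by blast
  moreover have "(- x - 2 * z)\<^sup>2 + 4 * (y - x - z) * z = M" unfolding q(7)[symmetric]
    by (simp add: algebra_simps power2_eq_square)
  moreover have "4 dvd - x - 2 * z - z" using q(2,5,6) by presburger
  ultimately show ?case using q by (simp add: crossing_def)
next
  case (3 q)
  then obtain x y z where q: "q = (x, y, z)" "even y" "odd z" "4 dvd x - z"
    by (auto simp: crossing_def)
  have "4 dvd (y - x - z) - y - 2" using q by presburger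
  then show ?case using q weight_flip by simp
qed auto

text \<open>The substitution (s, t) = (S + 2 T, -T) keeps y and replaces z by -f (2, -1), which is
  -z modulo 4; so chi4 changes sign.\<close>

lemma crossing_cancel_2: "sum weight {(x, y, z) \<in> crossing M. y < x + z \<and> 4 * y < z + 2 * x} = 0"
proof (rule sum_involution_zero[where t = "\<lambda>(x, y, z). (4 * y - x, y, z + 2 * x - 4 * y)"], goal_cases)
  case (1 q)
  then obtain x y z where q: "q = (x, y, z)" "even y" "0 < y" "0 < z" "odd z" "4 dvd x - z" "x\<^sup>2 + 4 * y * z = M"
    "y < x + z" "4 * y < z + 2 * x"
    by (auto simp: crossing_def)
  have "(4 * y - x)\<^sup>2 + 4 * y * (z + 2 * x - 4 * y) = M" unfolding q(7)[symmetric]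
    by (simp add: algebra_simps power2_eq_square)
  moreover have "4 dvd (4 * y - x) - (z + 2 * x - 4 * y)" using q(2,5,6) by presburger
  ultimately show ?case using q by (simp add: crossing_def)
next
  case (3 q)
  then obtain x y z where q: "q = (x, y, z)" "even y" "odd z" "4 dvd x - z"
    by (auto simp: crossing_def)
  have "(z + 2 * x - 4 * y) mod 4 = (- z) mod 4" using q by presburger
  then have "chi4 (z + 2 * x - 4 * y) = - chi4 z" using chi4_cong chi4_minus by metis
  then show ?case using q by (simp add: weight_def)
qed auto

text \<open>The substitution (s, t) = (S + 2 T, -S - T), followed by negation, replaces y by -f (1,
  -1) and z by f (2, -1). The residue of z modulo 4 is kept and y / 2 changes parity.\<close>

lemma crossing_cancel_3: "sum weight {(x, y, z) \<in> crossing M. y < x + z \<and> z + 2 * x < 4 * y} = 0"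
proof (rule sum_involution_zero[where t = "\<lambda>(x, y, z). (3 * x + 2 * z - 4 * y, x + z - y, 4 * y - 2 * x - z)"], goal_cases)
  case (1 q)
  then obtain x y z where q: "q = (x, y, z)" "even y" "0 < y" "0 < z" "odd z" "4 dvd x - z" "x\<^sup>2 + 4 * y * z = M"
    "y < x + z" "z + 2 * x < 4 * y"
    by (auto simp: crossing_def)
  have "odd x" using odd_crossing q by blast
  moreover have "(3 * x + 2 * z - 4 * y)\<^sup>2 + 4 * (x + z - y) * (4 * y - 2 * x - z) = M" unfolding q(7)[symmetric]
    by (simp add: algebra_simps power2_eq_square)
  moreover have "4 dvd (3 * x + 2 * z - 4 * y) - (4 * y - 2 * x - z)" using q(2,5,6) by presburger
  ultimately show ?case using q by (simp add: crossing_def)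
next
  case (3 q)
  then obtain x y z where q: "q = (x, y, z)" "even y" "odd z" "4 dvd x - z"
    by (auto simp: crossing_def)
  have "(4 * y - 2 * x - z) mod 4 = z mod 4" "4 dvd (x + z - y) - y - 2" using q by presburger+
  then show ?case using q weight_flip[OF _ chi4_cong] by simp
qed auto

lemma crossing_boundary:
  "sum weight (crossing M) = sum weight {(x, y, z) \<in> crossing M. y = x + z}"
proof -
  let ?A = "{(x, y, z) \<in> crossing M. x + z < y}"
  let ?B = "{(x, y, z) \<in> crossing M. y < x + z \<and> 4 * y < z + 2 * x}"
  let ?C = "{(x, y, z) \<in> crossing M. y < x + z \<and> z + 2 * x < 4 * y}"
  let ?D = "{(x, y, z) \<in> crossing M. y = x + z}"
  \<comment> \<open>f (2, -1) is odd, so the line between the second and third regions contains no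
    form.\<close>
  have ne: "4 * y \<noteq> z + 2 * x" if "(x, y, z) \<in> crossing M" for x y z
  proof -
    have "odd z" using that by (simp add: crossing_def)
    then show ?thesis by presburger
  qed
  have "crossing M = ?A \<union> (?B \<union> (?C \<union> ?D))"
  proof (intro equalityI subsetI)
    fix q assume q: "q \<in> crossing M"
    obtain x y z where "q = (x, y, z)" by (cases q)
    then show "q \<in> ?A \<union> (?B \<union> (?C \<union> ?D))" using q ne[of x y z] by auto
  qed auto
  then have "sum weight (crossing M) = sum weight (?A \<union> (?B \<union> (?C \<union> ?D)))" by simp
  also have "\<dots> = sum weight ?A + sum weight (?B \<union> (?C \<union> ?D))"
    by (intro sum.union_disjoint) (auto intro: finite_subset[OF _ finite_crossing[of M]])
  also have "sum weight (?B \<union> (?C \<union> ?D)) = sum weight ?B + sum weight (?C \<union> ?D)"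
    by (intro sum.union_disjoint) (auto intro: finite_subset[OF _ finite_crossing[of M]])
  also have "sum weight (?C \<union> ?D) = sum weight ?C + sum weight ?D"
    by (intro sum.union_disjoint) (auto intro: finite_subset[OF _ finite_crossing[of M]])
  finally show ?thesis by (simp only: crossing_cancel_1 crossing_cancel_2 crossing_cancel_3)
qed

text \<open>This counts the surviving forms of discriminant r^2. There are (r - 1) / 4 of them if r
  is 1 modulo 4 and (r + 1) / 4 if r is 3 modulo 4; the factor chi4 r merges the cases.\<close>

lemma card_residue_below:
  fixes r :: int
  assumes "odd r" "r > 0"
  shows "4 * (chi4 r * int (card {z. 0 < z \<and> z < r \<and> 4 dvd z + r})) = chi4 r * r - 1"
proof -
  have *: "card {z. 0 < z \<and> z < r \<and> 4 dvd z + r} = m"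
    if "\<And>z. (0 < z \<and> z < r \<and> 4 dvd z + r) \<longleftrightarrow> (\<exists>k\<in>{0..<int m}. z = 4 * k + c)" for m c
  proof -
    have "{z. 0 < z \<and> z < r \<and> 4 dvd z + r} = (\<lambda>k. 4 * k + c) ` {0..<int m}" using that by blast
    then show ?thesis by (simp add: card_image inj_on_def)
  qed
  define m where "m = nat (r div 4)"
  have m: "int m = r div 4" using assms(2) by (simp add: m_def)
  have "r mod 4 = 1 \<or> r mod 4 = 3" using assms(1) by presburger
  then show ?thesis
  proof
    assume r: "r mod 4 = 1"
    then have r': "r = 4 * int m + 1" using m by presburger
    have "card {z. 0 < z \<and> z < r \<and> 4 dvd z + r} = m"
    proof (rule *[of m 3])
      show "(0 < z \<and> z < r \<and> 4 dvd z + r) \<longleftrightarrow> (\<exists>k\<in>{0..<int m}. z = 4 * k + 3)" for z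
        unfolding r' Bex_def atLeastLessThan_iff by presburger
    qed
    then show ?thesis using r r' by (simp add: chi4_def)
  next
    assume r: "r mod 4 = 3"
    then have r': "r = 4 * int m + 3" using m by presburger
    have "card {z. 0 < z \<and> z < r \<and> 4 dvd z + r} = Suc m"
    proof (rule *[of "Suc m" 1])
      show "(0 < z \<and> z < r \<and> 4 dvd z + r) \<longleftrightarrow> (\<exists>k\<in>{0..<int (Suc m)}. z = 4 * k + 1)" for z
        unfolding r' Bex_def atLeastLessThan_iff of_nat_Suc by presburger
    qed
    then show ?thesis using r r' by (simp add: chi4_def)
  qed
qed

text \<open>The index set on the right has at most one element.\<close>

lemma sum_crossing:
  "4 * sum weight (crossing M) = (\<Sum>x\<in>{x. x mod 4 = 1 \<and> x\<^sup>2 = M}. x - 1)"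
proof (cases "\<exists>r. odd r \<and> r\<^sup>2 = M")
  case False
  have "{(x, y, z) \<in> crossing M. y = x + z} = {}"
  proof -
    have False if "(x, x + z, z) \<in> crossing M" for x z
    proof -
      have "odd z" "4 dvd x - z" "x\<^sup>2 + 4 * (x + z) * z = M" using that by (auto simp: crossing_def)
      moreover have "x\<^sup>2 + 4 * (x + z) * z = (x + 2 * z)\<^sup>2" by (simp add: algebra_simps power2_eq_square)
      moreover have "odd (x + 2 * z)" using odd_crossing calculation by simp
      ultimately show False using False by metis
    qed
    then show ?thesis by auto
  qed
  moreover have "{x. x mod 4 = 1 \<and> x\<^sup>2 = M} = {}"
  proof -
    have "odd x" if "x mod 4 = 1" for x :: int using that by presburger
    then show ?thesis using False by auto
  qed
  ultimately show ?thesis by (simp only: crossing_boundary sum.empty)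
next
  case True
  then obtain r' where r': "odd r'" "r'\<^sup>2 = M" by blast
  define r where "r = \<bar>r'\<bar>"
  have r: "odd r" "r > 0" "r\<^sup>2 = M" using r' by (auto simp: r_def)
  let ?Z = "{z. 0 < z \<and> z < r \<and> 4 dvd z + r}"
  \<comment> \<open>For y = x + z the discriminant is (x + 2 z)^2, so z determines the form. The
    weight is constant: chi4 z = - chi4 r, and y / 2 is odd.\<close>
  have "sum weight {(x, y, z) \<in> crossing M. y = x + z} = (\<Sum>z\<in>?Z. chi4 r)"
  proof (rule sum.reindex_bij_witness[of _ "\<lambda>z. (r - 2 * z, r - z, z)" "\<lambda>(x, y, z). z"])
    fix q assume "q \<in> {(x, y, z) \<in> crossing M. y = x + z}"
    then obtain x z where q: "q = (x, x + z, z)" "0 < x + z" "even (x + z)" "0 < z" "odd z" "4 dvd x - z"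
      "x\<^sup>2 + 4 * (x + z) * z = r\<^sup>2"
      using r(3) by (auto simp: crossing_def)
    have "(x + 2 * z)\<^sup>2 = r\<^sup>2" using q(7) by (simp add: algebra_simps power2_eq_square)
    then have x: "r = x + 2 * z" using q(2,4) r(2) by (auto simp: power2_eq_iff)
    then have z: "4 dvd z + r" using q(6) by presburger
    show "(case q of (x, y, z) \<Rightarrow> z) \<in> ?Z" using q x z by simp
    show "(\<lambda>z. (r - 2 * z, r - z, z)) (case q of (x, y, z) \<Rightarrow> z) = q" using q x by simp
    have "z mod 4 = (- r) mod 4" using z by presburger
    then have "chi4 z = - chi4 r" using chi4_cong chi4_minus by metis
    moreover have "odd ((x + z) div 2)" using q(5,6) by presburger
    ultimately show "chi4 r = weight q" by (simp add: q weight_def sign_def)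
  next
    fix z assume z: "z \<in> ?Z"
    then have "odd z" "4 dvd (r - 2 * z) - z" using r(1) by (simp, presburger)+
    moreover have "(r - 2 * z)\<^sup>2 + 4 * (r - z) * z = M"
      unfolding r(3)[symmetric] by (simp add: algebra_simps power2_eq_square)
    ultimately show "(r - 2 * z, r - z, z) \<in> {(x, y, z) \<in> crossing M. y = x + z}"
      using z r by (simp add: crossing_def)
  qed simp
  then have "4 * sum weight (crossing M) = chi4 r * r - 1"
    using card_residue_below[OF r(1,2)] by (simp add: crossing_boundary mult.commute)
  \<comment> \<open>Of the two square roots of M, chi4 r * r is the one that is 1 modulo 4.\<close>
  moreover have "{x. x mod 4 = 1 \<and> x\<^sup>2 = M} = {chi4 r * r}"
  proof -
    have "r mod 4 = 1 \<or> r mod 4 = 3" using r(1) by presburger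
    then show ?thesis
    proof
      assume *: "r mod 4 = 1"
      then have "(- r) mod 4 \<noteq> 1" by presburger
      then show ?thesis using * r(3) by (auto simp: chi4_def power2_eq_iff)
    next
      assume *: "r mod 4 = 3"
      then have "(- r) mod 4 = 1" by presburger
      then show ?thesis using * r(3) by (auto simp: chi4_def power2_eq_iff)
    qed
  qed
  ultimately show ?thesis by simp
qed

section \<open>From indefinite forms back to sums of two squares\<close>

text \<open>Put z = d and y = 2 e. Multiplying x by chi4 z turns the condition x = z modulo 4 into x
  = 1 modulo 4; even d may be added because chi4 d = 0.\<close>

lemma sum_crossing_unfold:
  "sum weight (crossing M)
    = (\<Sum>(x, d, e)\<in>{(x, d, e). x mod 4 = 1 \<and> 0 < d \<and> 0 < e \<and> x\<^sup>2 + 8 * (d * e) = M}. chi4 d * sign (d * e))"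
proof -
  let ?U = "{(x, d, e). x mod 4 = 1 \<and> 0 < d \<and> 0 < e \<and> x\<^sup>2 + 8 * (d * e) = M}"
  let ?V = "{(x, d, e) \<in> ?U. odd d}"
  have chi_sq: "chi4 z * chi4 z = 1" if "odd z" for z
  proof -
    have "z mod 4 = 1 \<or> z mod 4 = 3" using that by presburger
    then show ?thesis by (auto simp: chi4_def)
  qed
  have "sum weight (crossing M) = (\<Sum>(x, d, e)\<in>?V. chi4 d * sign (d * e))"
  proof (rule sum.reindex_bij_witness[of _ "\<lambda>(x, d, e). (chi4 d * x, 2 * e, d)" "\<lambda>(x, y, z). (chi4 z * x, z, y div 2)"])
    fix q assume "q \<in> crossing M"
    then obtain x e z where q: "q = (x, 2 * e, z)" "0 < e" "0 < z" "odd z" "4 dvd x - z" "x\<^sup>2 + 8 * (e * z) = M"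
      by (auto simp: crossing_def elim!: evenE)
    have "z mod 4 = 1 \<or> z mod 4 = 3" using q(4) by presburger
    then have "chi4 z * x mod 4 = 1"
    proof
      assume *: "z mod 4 = 1"
      then have "x mod 4 = 1" using q(5) by presburger
      then show ?thesis using * by (simp add: chi4_def)
    next
      assume *: "z mod 4 = 3"
      then have "(- x) mod 4 = 1" using q(5) by presburger
      then show ?thesis using * by (simp add: chi4_def)
    qed
    moreover have "(chi4 z * x)\<^sup>2 = x\<^sup>2" using chi_sq[OF q(4)] by (simp add: power_mult_distrib power2_eq_square)
    ultimately show "(case q of (x, y, z) \<Rightarrow> (chi4 z * x, z, y div 2)) \<in> ?V" using q by (simp add: mult.commute)
    show "(case case q of (x, y, z) \<Rightarrow> (chi4 z * x, z, y div 2) of (x, d, e) \<Rightarrow> (chi4 d * x, 2 * e, d)) = q"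
      using q chi_sq[OF q(4)] by (simp flip: mult.assoc)
    show "(case case q of (x, y, z) \<Rightarrow> (chi4 z * x, z, y div 2) of (x, d, e) \<Rightarrow> chi4 d * sign (d * e)) = weight q"
      using q by (simp add: weight_def sign_def)
  next
    fix q assume "q \<in> ?V"
    then obtain x d e where q: "q = (x, d, e)" "x mod 4 = 1" "0 < d" "0 < e" "x\<^sup>2 + 8 * (d * e) = M" "odd d"
      by auto
    have "d mod 4 = 1 \<or> d mod 4 = 3" using q(6) by presburger
    then have "4 dvd chi4 d * x - d"
    proof
      assume *: "d mod 4 = 1"
      then have "4 dvd x - d" using q(2) by presburger
      then show ?thesis using * by (simp add: chi4_def)
    next
      assume *: "d mod 4 = 3"
      then have "4 dvd - x - d" using q(2) by presburger
      then show ?thesis using * by (simp add: chi4_def)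
    qed
    moreover have "(chi4 d * x)\<^sup>2 = x\<^sup>2" using chi_sq[OF q(6)] by (simp add: power_mult_distrib power2_eq_square)
    ultimately show "(case q of (x, d, e) \<Rightarrow> (chi4 d * x, 2 * e, d)) \<in> crossing M"
      using q by (simp add: crossing_def mult.commute)
    show "(case case q of (x, d, e) \<Rightarrow> (chi4 d * x, 2 * e, d) of (x, y, z) \<Rightarrow> (chi4 z * x, z, y div 2)) = q"
      using q chi_sq[OF q(6)] by (simp flip: mult.assoc)
  qed
  also have "\<dots> = (\<Sum>(x, d, e)\<in>?U. chi4 d * sign (d * e))"
  proof (rule sum.mono_neutral_left)
    show "finite ?U"
    proof (rule finite_subset)
      show "?U \<subseteq> {-M..M} \<times> {0..M} \<times> {0..M}"
      proof (rule subsetI)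
        fix q assume "q \<in> ?U"
        then obtain x d e where q: "q = (x, d, e)" "0 < d" "0 < e" "x\<^sup>2 + 8 * (d * e) = M" by auto
        have "d * 1 \<le> d * e" "1 * e \<le> d * e" using q by (intro mult_left_mono mult_right_mono; simp)+
        then have "\<bar>x\<bar> \<le> M" "d \<le> M" "e \<le> M"
          using abs_le_square_int[of x] zero_le_power2[of x] q(2-4) by linarith+
        then show "q \<in> {-M..M} \<times> {0..M} \<times> {0..M}" using q by auto
      qed
    qed simp
    have "chi4 d = 0" if "even d" for d
    proof -
      have "d mod 4 \<noteq> 1" "d mod 4 \<noteq> 3" using that by presburger+
      then show ?thesis by (simp add: chi4_def)
    qed
    then show "\<forall>q\<in>?U - ?V. (case q of (x, d, e) \<Rightarrow> chi4 d * sign (d * e)) = 0" by auto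
  qed auto
  finally show ?thesis .
qed

text \<open>In terms of \<open>q\<close>-series this is
  \<open>\<psi>(q) \<phi>(-q)\<^sup>2 = \<Sum>\<^bsub>j\<ge>0\<^esub> (-1)\<^sup>j (2 j + 1) q\<^bsup>j(j+1)/2\<^esup>\<close>, Jacobi's formula for the cube of the
  Euler product.\<close>

lemma alternating_sum_eq:
  "(\<Sum>(x, u, v)\<in>{(x, u, v). x mod 4 = 1 \<and> x\<^sup>2 + 8 * u\<^sup>2 + 8 * v\<^sup>2 = M}. sign (u + v))
    = (\<Sum>x\<in>{x. x mod 4 = 1 \<and> x\<^sup>2 = M}. x)"
proof -
  let ?X = "{x. x mod 4 = 1 \<and> x\<^sup>2 \<le> M \<and> 8 dvd M - x\<^sup>2}"
  let ?Xz = "{x. x mod 4 = 1 \<and> x\<^sup>2 = M}" and ?Xp = "{x. x mod 4 = 1 \<and> x\<^sup>2 < M \<and> 8 dvd M - x\<^sup>2}"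
  let ?k = "\<lambda>x. (M - x\<^sup>2) div 8"
  have le: "x \<in> {-M..M}" if "x\<^sup>2 \<le> M" for x using that abs_le_square_int[of x] by auto
  have fin: "finite ?Xz" "finite ?Xp"
    by (rule finite_subset[of _ "{-M..M}"]; use le in force)+
  have un: "?X = ?Xz \<union> ?Xp" by (auto simp: order_le_less)
  \<comment> \<open>u + v has the parity of u^2 + v^2 = (M - x^2) / 8, so the sign depends on x
    only.\<close>
  have "(\<Sum>(x, u, v)\<in>{(x, u, v). x mod 4 = 1 \<and> x\<^sup>2 + 8 * u\<^sup>2 + 8 * v\<^sup>2 = M}. sign (u + v))
    = (\<Sum>(x, u, v)\<in>Sigma ?X (\<lambda>x. reps 1 (?k x)). sign (?k x))"
  proof (rule sum.cong)
    show "{(x, u, v). x mod 4 = 1 \<and> x\<^sup>2 + 8 * u\<^sup>2 + 8 * v\<^sup>2 = M} = Sigma ?X (\<lambda>x. reps 1 (?k x))"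
      by (auto simp: reps_def)
    fix q assume "q \<in> Sigma ?X (\<lambda>x. reps 1 (?k x))"
    then obtain x u v where q: "q = (x, u, v)" "u\<^sup>2 + v\<^sup>2 = ?k x" by (auto simp: reps_def)
    then show "(case q of (x, u, v) \<Rightarrow> sign (u + v)) = (case q of (x, u, v) \<Rightarrow> sign (?k x))"
      by (simp add: sign_def flip: q(2))
  qed
  also have "\<dots> = (\<Sum>x\<in>?X. \<Sum>(u, v)\<in>reps 1 (?k x). sign (?k x))"
    using fin unfolding un by (subst sum.Sigma) (auto simp: finite_reps)
  also have "\<dots> = (\<Sum>x\<in>?X. int (card (reps 1 (?k x))) * sign (?k x))"
    by (simp add: case_prod_unfold)
  also have "\<dots> = (\<Sum>x\<in>?Xz. int (card (reps 1 (?k x))) * sign (?k x)) + (\<Sum>x\<in>?Xp. int (card (reps 1 (?k x))) * sign (?k x))"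
    using fin unfolding un by (intro sum.union_disjoint) auto
  \<comment> \<open>Here u = v = 0, a case outside the divisor formula. Each such x contributes 1,
    which turns the x - 1 of \<open>sum_crossing\<close> into x.\<close>
  also have "(\<Sum>x\<in>?Xz. int (card (reps 1 (?k x))) * sign (?k x)) = (\<Sum>x\<in>?Xz. 1)"
    by (intro sum.cong refl) (auto simp: card_reps_1_0 sign_def)
  also have "(\<Sum>x\<in>?Xp. int (card (reps 1 (?k x))) * sign (?k x)) = (\<Sum>x\<in>?Xp. \<Sum>d\<in>pos_divs (?k x). 4 * (chi4 d * sign (?k x)))"
  proof (rule sum.cong[OF refl])
    fix x assume "x \<in> ?Xp"
    then have "?k x > 0" by (auto elim!: dvdE)
    then obtain k where k: "?k x = int k" "k > 0" by (metis zero_less_imp_eq_int)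
    show "int (card (reps 1 (?k x))) * sign (?k x) = (\<Sum>d\<in>pos_divs (?k x). 4 * (chi4 d * sign (?k x)))"
      unfolding k(1) card_two_squares[OF k(2)]
      by (simp add: divisor_sum_pos_divs[OF k(2), symmetric] sum_distrib_left sum_distrib_right mult.assoc)
  qed
  also have "\<dots> = (\<Sum>(x, d)\<in>Sigma ?Xp (\<lambda>x. pos_divs (?k x)). 4 * (chi4 d * sign (?k x)))"
  proof (rule sum.Sigma[OF fin(2)], rule ballI)
    fix x assume "x \<in> ?Xp"
    then have "?k x > 0" by (auto elim!: dvdE)
    then show "finite (pos_divs (?k x))" by (rule finite_pos_divs)
  qed
  also have "\<dots> = (\<Sum>(x, d, e)\<in>{(x, d, e). x mod 4 = 1 \<and> 0 < d \<and> 0 < e \<and> x\<^sup>2 + 8 * (d * e) = M}. 4 * (chi4 d * sign (d * e)))"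
  proof (rule sum.reindex_bij_witness[of _ "\<lambda>(x, d, e). (x, d)" "\<lambda>(x, d). (x, d, ?k x div d)"], goal_cases)
    case (2 q)
    then obtain x d where q: "q = (x, d)" "x mod 4 = 1" "x\<^sup>2 < M" "8 dvd M - x\<^sup>2" "0 < d" "d dvd ?k x"
      by (auto simp: pos_divs_def)
    from q(4) obtain k where k: "M - x\<^sup>2 = 8 * k" by (rule dvdE)
    then have "k > 0" "d dvd k" using q(3,6) by simp_all
    then have "k div d > 0" using q(5) by (simp add: pos_imp_zdiv_pos_iff zdvd_imp_le)
    then show ?case using q(1,2,5) k \<open>d dvd k\<close> by simp
  next
    case (3 q)
    then obtain x d e where q: "q = (x, d, e)" "0 < d" "M - x\<^sup>2 = 8 * (d * e)" by auto
    then show ?case by simp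
  next
    case (4 q)
    then obtain x d e where q: "q = (x, d, e)" "x mod 4 = 1" "0 < d" "0 < e" "M - x\<^sup>2 = 8 * (d * e)" by auto
    moreover have "0 < d * e" using q by simp
    then have "x\<^sup>2 < M" using q(5) by linarith
    ultimately show ?case by (simp add: pos_divs_def)
  next
    case (5 q)
    then show ?case by (auto simp: pos_divs_def)
  qed auto
  also have "\<dots> = 4 * sum weight (crossing M)"
    unfolding sum_crossing_unfold by (simp add: sum_distrib_left case_prod_unfold)
  also have "(\<Sum>x\<in>?Xz. 1) + 4 * sum weight (crossing M) = (\<Sum>x\<in>?Xz. x)"
    unfolding sum_crossing by (simp add: sum_subtractf)
  finally show ?thesis .
qed

subsection \<open>The number of representations by triangular numbers\<close>

text \<open>x is odd, and negating it exchanges the classes 1 and 3 modulo 4, whence the factor 2.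
  For fixed y, \<open>alternating_sum_eq\<close> with M = n - 2 y^2 leaves only the solutions of x^2
  + 2 y^2 = n.\<close>

lemma alternating_reps4_eq_S:
  fixes n :: nat
  assumes "odd n"
  shows "(\<Sum>(x, y, u, v)\<in>reps4 8 (int n). sign (u + v)) = 2 * S 2 n"
proof -
  let ?s = "\<lambda>(x, y, u, v). sign (u + v)"
  let ?R = "reps4 8 (int n)"
  let ?Ra = "{(x, y, u, v) \<in> ?R. x mod 4 = 1}" and ?Rb = "{(x, y, u, v) \<in> ?R. x mod 4 = 3}"
  let ?Y = "{- int n..int n}"
  have fin: "finite ?R" by (rule finite_reps4) simp
  have odd: "x mod 4 = 1 \<or> x mod 4 = 3" if "(x, y, u, v) \<in> ?R" for x y u v
  proof -
    have "x\<^sup>2 = int n - 2 * (y\<^sup>2 + 4 * u\<^sup>2 + 4 * v\<^sup>2)" using that by (simp add: reps4_def)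
    then have "odd (x\<^sup>2)" using assms by simp
    then have "odd x" by simp
    then show ?thesis by presburger
  qed
  have "?R = ?Ra \<union> ?Rb" using odd by auto
  then have "sum ?s ?R = sum ?s (?Ra \<union> ?Rb)" by simp
  also have "\<dots> = sum ?s ?Ra + sum ?s ?Rb"
    by (intro sum.union_disjoint) (auto intro: finite_subset[OF _ fin])
  also have "sum ?s ?Rb = sum ?s ?Ra"
  proof -
    have neg: "x mod 4 = 3 \<longleftrightarrow> (- x) mod 4 = 1" for x :: int by presburger
    show ?thesis
      by (rule sum.reindex_bij_witness[of _ "\<lambda>(x, y, u, v). (- x, y, u, v)" "\<lambda>(x, y, u, v). (- x, y, u, v)"])
        (auto simp: reps4_def neg)
  qed
  also have "sum ?s ?Ra = (\<Sum>(y, x, u, v)\<in>Sigma ?Y (\<lambda>y. {(x, u, v). x mod 4 = 1 \<and> x\<^sup>2 + 8 * u\<^sup>2 + 8 * v\<^sup>2 = int n - 2 * y\<^sup>2}). sign (u + v))"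
  proof (rule sum.reindex_bij_witness[of _ "\<lambda>(y, x, u, v). (x, y, u, v)" "\<lambda>(x, y, u, v). (y, x, u, v)"], goal_cases)
    case (2 q)
    then obtain x y u v where q: "q = (x, y, u, v)" "x mod 4 = 1" "x\<^sup>2 + 2 * y\<^sup>2 + 8 * u\<^sup>2 + 8 * v\<^sup>2 = int n"
      by (auto simp: reps4_def)
    then have "\<bar>y\<bar> \<le> int n"
      using abs_le_square_int[of y] zero_le_power2[of x] zero_le_power2[of y] zero_le_power2[of u] zero_le_power2[of v]
      by linarith
    then show ?case using q by auto
  qed (auto simp: reps4_def)
  also have "\<dots> = (\<Sum>y\<in>?Y. \<Sum>(x, u, v)\<in>{(x, u, v). x mod 4 = 1 \<and> x\<^sup>2 + 8 * u\<^sup>2 + 8 * v\<^sup>2 = int n - 2 * y\<^sup>2}. sign (u + v))"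
  proof (rule sum.Sigma[symmetric])
    show "\<forall>y\<in>?Y. finite {(x, u, v). x mod 4 = 1 \<and> x\<^sup>2 + 8 * u\<^sup>2 + 8 * v\<^sup>2 = int n - 2 * y\<^sup>2}"
    proof
      fix y
      have "{(x, u, v). x mod 4 = 1 \<and> x\<^sup>2 + 8 * u\<^sup>2 + 8 * v\<^sup>2 = int n - 2 * y\<^sup>2} \<subseteq> (\<lambda>(x, y, u, v). (x, u, v)) ` ?R"
      proof (rule subsetI)
        fix q assume "q \<in> {(x, u, v). x mod 4 = 1 \<and> x\<^sup>2 + 8 * u\<^sup>2 + 8 * v\<^sup>2 = int n - 2 * y\<^sup>2}"
        then obtain x u v where q: "q = (x, u, v)" "(x, y, u, v) \<in> ?R" by (auto simp: reps4_def)
        show "q \<in> (\<lambda>(x, y, u, v). (x, u, v)) ` ?R" by (rule rev_image_eqI[OF q(2)]) (simp add: q(1))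
      qed
      then show "finite {(x, u, v). x mod 4 = 1 \<and> x\<^sup>2 + 8 * u\<^sup>2 + 8 * v\<^sup>2 = int n - 2 * y\<^sup>2}"
        by (rule finite_subset) (simp add: fin)
    qed
  qed simp
  also have "\<dots> = (\<Sum>y\<in>?Y. \<Sum>x\<in>{x. x mod 4 = 1 \<and> x\<^sup>2 = int n - 2 * y\<^sup>2}. x)"
    by (simp only: alternating_sum_eq)
  also have "\<dots> = (\<Sum>(y, x)\<in>Sigma ?Y (\<lambda>y. {x. x mod 4 = 1 \<and> x\<^sup>2 = int n - 2 * y\<^sup>2}). x)"
  proof (rule sum.Sigma)
    show "\<forall>y\<in>?Y. finite {x. x mod 4 = 1 \<and> x\<^sup>2 = int n - 2 * y\<^sup>2}"
    proof
      fix y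
      have "{x. x mod 4 = 1 \<and> x\<^sup>2 = int n - 2 * y\<^sup>2} \<subseteq> fst ` reps 2 (int n)"
      proof (rule subsetI)
        fix x assume "x \<in> {x. x mod 4 = 1 \<and> x\<^sup>2 = int n - 2 * y\<^sup>2}"
        then have "(x, y) \<in> reps 2 (int n)" by (simp add: reps_def)
        then show "x \<in> fst ` reps 2 (int n)" by (rule rev_image_eqI) simp
      qed
      then show "finite {x. x mod 4 = 1 \<and> x\<^sup>2 = int n - 2 * y\<^sup>2}"
        by (rule finite_subset) (simp add: finite_reps)
    qed
  qed simp
  also have "\<dots> = S 2 n"
    unfolding S_def
  proof (rule sum.reindex_bij_witness[of _ "\<lambda>(r, s). (s, r)" "\<lambda>(s, r). (r, s)"], goal_cases)
    case (4 q)
    then obtain r s where q: "q = (r, s)" "r mod 4 = 1" "int n = r\<^sup>2 + 2 * s\<^sup>2" by (auto simp: cong_def)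
    then have "\<bar>s\<bar> \<le> int n"
      using abs_le_square_int[of s] zero_le_power2[of r] zero_le_power2[of s] by linarith
    then show ?case using q by auto
  qed (auto simp: cong_def)
  finally show ?thesis by simp
qed

text \<open>Multiplication by 8 completes the squares and adds 1 + 2 + 4 + 4 = 11. For odd Z = 2 z -
  1 and W = 2 w - 1, 4 (Z^2 + W^2) = 8 (u^2 + v^2) with u = (Z + W) / 2 and v = (Z - W) / 2; then u
  + v = Z is odd.\<close>

lemma tri_reps_eq:
  "tri_reps 1 2 4 4 n = card {(x, y, u, v) \<in> reps4 8 (int (8 * n + 11)). odd (u + v)}"
proof -
  let ?A = "{(x :: int, y :: int, z :: int, w :: int).
     int n = int 1 * (x * (x - 1) div 2) + int 2 * (y * (y - 1) div 2)
           + int 4 * (z * (z - 1) div 2) + int 4 * (w * (w - 1) div 2)}"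
  let ?B = "{(x, y, u, v) \<in> reps4 8 (int (8 * n + 11)). odd (u + v)}"
  have tri: "8 * (x * (x - 1) div 2) = (2 * x - 1)\<^sup>2 - 1" for x :: int
  proof -
    have "even (x * (x - 1))" by simp
    then obtain t where "x * (x - 1) = 2 * t" by (rule evenE)
    then show ?thesis by (simp add: algebra_simps power2_eq_square)
  qed
  have iff: "(x, y, z, w) \<in> ?A \<longleftrightarrow> (2 * x - 1, 2 * y - 1, z + w - 1, z - w) \<in> reps4 8 (int (8 * n + 11))" for x y z w
  proof -
    have "m = 1 * a + 2 * b + 4 * c + 4 * d \<longleftrightarrow> 8 * a + 2 * (8 * b) + 4 * (8 * c) + 4 * (8 * d) = 8 * m"
      for m a b c d :: int by presburger
    then have "(x, y, z, w) \<in> ?A \<longleftrightarrow> 8 * (x * (x - 1) div 2) + 2 * (8 * (y * (y - 1) div 2))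
           + 4 * (8 * (z * (z - 1) div 2)) + 4 * (8 * (w * (w - 1) div 2)) = 8 * int n"
      unfolding mem_Collect_eq prod.case of_nat_1 of_nat_numeral by blast
    also have "\<dots> \<longleftrightarrow> (2 * x - 1, 2 * y - 1, z + w - 1, z - w) \<in> reps4 8 (int (8 * n + 11))"
      unfolding tri by (simp add: reps4_def algebra_simps power2_eq_square)
    finally show ?thesis .
  qed
  have "bij_betw (\<lambda>(x, y, z, w). (2 * x - 1, 2 * y - 1, z + w - 1, z - w)) ?A ?B"
  proof (rule bij_betw_byWitness[where f' = "\<lambda>(x, y, u, v). ((x + 1) div 2, (y + 1) div 2, (u + v + 1) div 2, (u - v + 1) div 2)"])
    let ?f = "\<lambda>(x::int, y::int, z::int, w::int). (2 * x - 1, 2 * y - 1, z + w - 1, z - w)"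
    let ?g = "\<lambda>(x::int, y::int, u::int, v::int). ((x + 1) div 2, (y + 1) div 2, (u + v + 1) div 2, (u - v + 1) div 2)"
    have inv: "?f (?g q) = q" if "q \<in> ?B" for q
    proof -
      from that obtain x y u v where q: "q = (x, y, u, v)" "odd (u + v)"
        "x\<^sup>2 + 2 * y\<^sup>2 + 8 * u\<^sup>2 + 8 * v\<^sup>2 = 8 * int n + 11"
        by (auto simp: reps4_def)
      define X Y Z where "X = x\<^sup>2" and "Y = y\<^sup>2" and "Z = u\<^sup>2 + v\<^sup>2"
      have e: "X + 2 * Y + 8 * Z = 8 * int n + 11" using q(3) by (simp add: X_def Y_def Z_def)
      then have "odd X" by presburger
      then have x: "odd x" "X mod 8 = 1" using odd_square_mod_8 by (simp_all add: X_def)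
      \<comment> \<open>Modulo 8 the equation reads 1 + 2 Y = 3; so y is odd, and halving y + 1 is
        exact.\<close>
      have "Y mod 4 = 1" using e x(2) by presburger
      then have "odd y" using even_square_mod_4[of y] by (auto simp: Y_def)
      then have "2 * ((x + 1) div 2) = x + 1" "2 * ((y + 1) div 2) = y + 1" using x(1) by presburger+
      moreover have "(u + v + 1) div 2 + (u - v + 1) div 2 = u + 1" "(u + v + 1) div 2 - (u - v + 1) div 2 = v"
        using q(2) by presburger+
      ultimately show ?thesis by (simp add: q(1))
    qed
    then show "\<forall>q\<in>?B. ?f (?g q) = q" by blast
    show "\<forall>q\<in>?A. ?g (?f q) = q" by auto
    show "?f ` ?A \<subseteq> ?B"
    proof (rule image_subsetI)
      fix q assume q: "q \<in> ?A"
      obtain x y z w where xyzw: "q = (x, y, z, w)" by (cases q)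
      have "(2 * x - 1, 2 * y - 1, z + w - 1, z - w) \<in> reps4 8 (int (8 * n + 11))"
        using q unfolding xyzw iff .
      moreover have "odd ((z + w - 1) + (z - w))" by presburger
      ultimately show "?f q \<in> ?B" unfolding xyzw mem_Collect_eq prod.case by (rule conjI)
    qed
    show "?g ` ?B \<subseteq> ?A"
    proof (rule image_subsetI)
      fix q assume q: "q \<in> ?B"
      obtain x y z w where xyzw: "?g q = (x, y, z, w)" by (cases "?g q")
      have "?f (x, y, z, w) \<in> reps4 8 (int (8 * n + 11))" using inv[OF q] q unfolding xyzw by auto
      then show "?g q \<in> ?A" using iff[of x y z w] unfolding xyzw by simp
    qed
  qed
  then show ?thesis unfolding tri_reps_def by (rule bij_betw_same_card)
qed

theorem theorem3p4:
  fixes n :: nat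
  assumes "n \<ge> 1"
  shows "int (tri_reps 1 2 4 4 n)
    = - (\<Sum>d | d dvd 8 * n + 11. int d * Jacobi 2 d) - S 2 (8 * n + 11)"
proof -
  let ?N = "8 * n + 11"
  let ?R = "reps4 8 (int ?N)"
  let ?Re = "{(x, y, u, v) \<in> ?R. even (u + v)}" and ?Ro = "{(x, y, u, v) \<in> ?R. odd (u + v)}"
  have fin: "finite ?R" by (rule finite_reps4) simp
  have fin': "finite ?Re" "finite ?Ro" by (rule finite_subset[OF _ fin], blast)+
  have un: "?R = ?Re \<union> ?Ro" and dis: "?Re \<inter> ?Ro = {}" by auto
  have "int (card ?R) = int (card ?Re) + int (card ?Ro)"
    using card_Un_disjoint[OF fin' dis] un by simp
  moreover have "(\<Sum>(x, y, u, v)\<in>?R. sign (u + v)) = (\<Sum>(x, y, u, v)\<in>?Re \<union> ?Ro. sign (u + v))"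
    using un by simp
  moreover have "\<dots> = (\<Sum>(x, y, u, v)\<in>?Re. sign (u + v)) + (\<Sum>(x, y, u, v)\<in>?Ro. sign (u + v))"
    by (rule sum.union_disjoint[OF fin' dis])
  moreover have "(\<Sum>(x, y, u, v)\<in>?Re. sign (u + v)) = (\<Sum>q\<in>?Re. 1)"
    by (intro sum.cong refl) (auto simp: sign_def)
  moreover have "(\<Sum>(x, y, u, v)\<in>?Ro. sign (u + v)) = (\<Sum>q\<in>?Ro. - 1)"
    by (intro sum.cong refl) (auto simp: sign_def)
  ultimately have "2 * int (card ?Ro) = int (card ?R) - (\<Sum>(x, y, u, v)\<in>?R. sign (u + v))"
    by simp
  also have "(\<Sum>(x, y, u, v)\<in>?R. sign (u + v)) = 2 * S 2 ?N"
    by (rule alternating_reps4_eq_S) simp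
  also have "int (card ?R) = - 2 * (\<Sum>d | d dvd ?N. int d * chi8 (int d))"
  proof (rule card_reps4_8_eq)
    show "?N mod 8 = 3" by presburger
  qed
  also have "(\<Sum>d | d dvd ?N. int d * chi8 (int d)) = (\<Sum>d | d dvd ?N. int d * Jacobi 2 d)"
  proof (rule sum.cong[OF refl])
    fix d assume "d \<in> {d. d dvd ?N}"
    then have "odd d" using dvd_trans[of 2 d ?N] by auto
    then show "int d * chi8 (int d) = int d * Jacobi 2 d" by (simp add: Jacobi_two)
  qed
  finally show ?thesis unfolding tri_reps_eq by linarith
qed

end
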